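(* Let $d=m$, let $f:\mathbb{R}^d\times\mathbb{R}^m\to\mathbb{R}$ be of the form $f(x,\xi)=a\bigl(\xi_m-(\xi_{1:m-1};1)^\top x\bigr)^2$ with $a>0$, and let $$\mathcal C=\bigl\{(x_{\mathrm v},\lambda_{\mathrm v})\in\mathbb{R}^{nd}\times\mathbb{R}^n_{\ge0}\;\big|\;\lambda^i\ge a\|(x^i_{1:m-1};1)\|^2\text{ for all }i\in\{1,\dots,n\}\bigr\}.$$ Assume further that there exists a saddle point $(x_{\mathrm v}^*,\lambda_{\mathrm v}^*,\nu^*,\eta^*,\{(\xi^k)^*\})$ of $\tilde L_{\mathrm{aug}}$ over $\mathcal C\times(\mathbb{R}^n\times\mathbb{R}^{nd}\times\mathbb{R}^{mN})$ satisfying $(x_{\mathrm v}^*,\lambda_{\mathrm v}^* )\in\mathrm{int}(\mathcal C)$. Then the trajectories of the saddle-point dynamics (SP) stated in the context starting in $\mathcal C\times\mathbb{R}^n\times\mathbb{R}^{nd}\times\mathbb{R}^{mN}$ remain in this set and converge asymptotically (as $t\to\infty$) to a saddle point of $\tilde L_{\mathrm{aug}}$ over $\mathcal C\times(\mathbb{R}^n\times\mathbb{R}^{nd}\times\mathbb{R}^{mN})$. As a consequence, the $(x_{\mathrm v},\lambda_{\mathrm v})$ component of the trajectory converges to an optimizer of problem (D) stated in the context.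
   Context: $n,N,d,m$ are positive integers and $\epsilon\ge 0$. For $y\in\mathbb{R}^m$, $y_{1:m-1}\in\mathbb{R}^{m-1}$ denotes $y$ without its last component $y_m$, and $(y_{1:m-1};1)\in\mathbb{R}^m$ is its concatenation with $1$. $\mathcal G$ is a connected undirected weighted graph on the vertex set $\{1,\dots,n\}$ (the agents) with symmetric adjacency matrix $\mathsf A=(a_{ij})$, $a_{ij}>0$ if $(i,j)$ is an edge and $a_{ij}=0$ otherwise; $\mathsf L=\mathsf D-\mathsf A$ is its Laplacian, where $\mathsf D$ is the diagonal matrix with entries $\sum_j a_{ij}$. The samples $\hat\xi^{\,1},\dots,\hat\xi^{\,N}\in\mathbb{R}^m$ are distributed among the agents: each sample is held by exactly one agent and each agent holds at least one; $v_k\in\{1,\dots,n\}$ is the agent holding $\hat\xi^{\,k}$. Notation: $h(\lambda_{\mathrm v}):=\epsilon^2(\mathbf 1_n^\top\lambda_{\mathrm v})/n$; $g_k(x,\lambda,\xi):=f(x,\xi)-\lambda\|\xi-\hat\xi^{\,k}\|^2$; $x_{\mathrm v}=(x^1;\dots;x^n)$ with $x^i\in\mathbb{R}^d$; $\lambda_{\mathrm v}=(\lambda^1;\dots;\lambda^n)$ with $\lambda^i\in\mathbb{R}$; $\nu\in\mathbb{R}^n$; $\eta\in\mathbb{R}^{nd}$; $\{\xi^k\}=(\xi^1,\dots,\xi^N)$ with $\xi^k\in\mathbb{R}^m$; $$F(x_{\mathrm v},\lambda_{\mathrm v}):=h(\lambda_{\mathrm v})+\frac1N\sum_{k=1}^N\max_{\xi\in\mathbb{R}^m}g_k(x^{v_k},\lambda^{v_k},\xi)\in(-\infty,+\infty],$$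 $$\tilde L_{\mathrm{aug}}(x_{\mathrm v},\lambda_{\mathrm v},\nu,\eta,\{\xi^k\}):=h(\lambda_{\mathrm v})+\frac1N\sum_{k=1}^Ng_k(x^{v_k},\lambda^{v_k},\xi^k)+\nu^\top\mathsf L\lambda_{\mathrm v}+\eta^\top(\mathsf L\otimes\mathsf I_d)x_{\mathrm v}+\tfrac12x_{\mathrm v}^\top(\mathsf L\otimes\mathsf I_d)x_{\mathrm v}+\tfrac12\lambda_{\mathrm v}^\top\mathsf L\lambda_{\mathrm v}.$$ $\mathbf 1_n,\mathbf 0_n$ are the all-ones and zero vectors, $\mathsf I_d$ the identity, $\otimes$ the Kronecker product; vector inequalities are componentwise. Problem (D): minimize $F(x_{\mathrm v},\lambda_{\mathrm v})$ over $x_{\mathrm v}\in\mathbb{R}^{nd}$, $\lambda_{\mathrm v}\ge\mathbf 0_n$ subject to $\mathsf L\lambda_{\mathrm v}=\mathbf 0_n$ and $(\mathsf L\otimes\mathsf I_d)x_{\mathrm v}=\mathbf 0_{nd}$. Standing assumption: for problem (P), $\inf_{\lambda\ge0,\,x\in\mathbb{R}^d}\{\lambda\epsilon^2+\frac1N\sum_{k=1}^N\max_{\xi\in\mathbb{R}^m}g_k(x,\lambda,\xi)\}$, the set of $(\lambda,x)\in\mathbb{R}_{\ge0}\times\mathbb{R}^d$ at which the objective is finite has nonempty interior, and there exists a finite optimizer $(x^*,\lambda^* )$. A point $(p_*,q_* )\in\mathcal P\times\mathcal Q$ is a saddle point of $\Phi$ over $\mathcal P\times\mathcal Q$ if $\Phi(p_*,q)\le\Phi(p_*,q_*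 )\le\Phi(p,q_* )$ for all $p\in\mathcal P$, $q\in\mathcal Q$. For a closed convex set $\mathcal K$, $y\in\mathcal K$ and a vector $w$, $\Pi_{\mathcal K}(y,w):=\lim_{\delta\to0^+}\frac{\mathrm{proj}_{\mathcal K}(y+\delta w)-y}{\delta}$, where $\mathrm{proj}_{\mathcal K}$ is the Euclidean projection onto $\mathcal K$. The saddle-point dynamics (SP) is, with all gradients of $\tilde L_{\mathrm{aug}}$ evaluated at $(x_{\mathrm v},\lambda_{\mathrm v},\nu,\eta,\{\xi^k\})$, $$\frac{d}{dt}\begin{bmatrix}x_{\mathrm v}\\ \lambda_{\mathrm v}\end{bmatrix}=\Pi_{\mathcal C}\Bigl((x_{\mathrm v},\lambda_{\mathrm v}),\begin{bmatrix}-\nabla_{x_{\mathrm v}}\tilde L_{\mathrm{aug}}\\-\nabla_{\lambda_{\mathrm v}}\tilde L_{\mathrm{aug}}\end{bmatrix}\Bigr),\quad \frac{d\nu}{dt}=\nabla_\nu\tilde L_{\mathrm{aug}},\quad\frac{d\eta}{dt}=\nabla_\eta\tilde L_{\mathrm{aug}},\quad\frac{d\xi^k}{dt}=\nabla_{\xi^k}\tilde L_{\mathrm{aug}}\;\;(k=1,\dots,N).$$ Trajectories are Caratheodory solutions: absolutely continuous curves satisfying the equations for almost every time. *)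

theory Defs
  imports "HOL-Analysis.Analysis"
begin

section \<open>Vectors and matrices\<close>

text \<open>
  The coordinates of an \<open>m\<close>-vector are indexed by a finite linearly ordered type \<open>'m\<close>; the last
  component is the one at the greatest index.
\<close>

definition last_index :: "'m::{finite,linorder}" where
  "last_index = Max UNIV"

text \<open>\<open>(y\<^bsub>1:m-1\<^esub>; 1)\<close>: the last component of \<open>y\<close> is replaced by \<open>1\<close>.\<close>

definition last_to_one :: "real^('m::{finite,linorder}) \<Rightarrow> real^('m::{finite,linorder})" where
  "last_to_one y = (\<chi> j. if j = last_index then 1 else y $ j)"

text \<open>
  A stacked vector \<open>x\<^sub>v = (x\<^sup>1; \<dots>; x\<^sup>n)\<close> of \<open>n\<close> blocks of size \<open>d\<close> has index type \<open>'n \<times> 'd\<close>, with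
  \<open>(i, j)\<close> the index of component \<open>j\<close> of block \<open>i\<close>; this is also the indexing of the Kronecker
  product.
\<close>

definition block :: "real^('n \<times> 'd) \<Rightarrow> 'n::finite \<Rightarrow> real^('d::finite)" where
  "block x i = (\<chi> j. x $ (i, j))"

definition kron :: "real^'b^'a \<Rightarrow> real^'d^'c \<Rightarrow> real^('b::finite \<times> 'd::finite)^('a::finite \<times> 'c::finite)"
    (infixl "\<otimes>\<^sub>K" 70) where
  "M \<otimes>\<^sub>K K = (\<chi> p q. M $ fst p $ fst q * K $ snd p $ snd q)"


section \<open>Weighted graphs\<close>

definition connected_weighted_graph :: "('n \<times> 'n) set \<Rightarrow> real^'n^('n::finite) \<Rightarrow> bool" where
  "connected_weighted_graph E A \<longleftrightarrow>
     sym E \<and> transpose A = A \<and>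
     (\<forall>i j. (i, j) \<in> E \<longrightarrow> A $ i $ j > 0) \<and> (\<forall>i j. (i, j) \<notin> E \<longrightarrow> A $ i $ j = 0) \<and>
     (\<forall>i j. (i, j) \<in> E\<^sup>*)"

definition degree_matrix :: "real^'n^'n \<Rightarrow> real^'n^('n::finite)" where
  "degree_matrix A = (\<chi> i j. if i = j then \<Sum>k\<in>UNIV. A $ i $ k else 0)"

definition laplacian :: "real^'n^'n \<Rightarrow> real^'n^('n::finite)" where
  "laplacian A = degree_matrix A - A"


section \<open>The optimization problems\<close>

text \<open>
  Throughout, \<open>f\<close> is the objective, \<open>xhat k\<close> the \<open>k\<close>-th sample, \<open>v k\<close> the agent holding it, and
  \<open>eps\<close> the radius.
\<close>

definition g_fun ::
    "(real^'d \<Rightarrow> real^'m \<Rightarrow> real) \<Rightarrow> ('N \<Rightarrow> real^'m) \<Rightarrow> 'N \<Rightarrow>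
     real^('d::finite) \<Rightarrow> real \<Rightarrow> real^('m::finite) \<Rightarrow> real" where
  "g_fun f xhat k x l \<xi> = f x \<xi> - l * (norm (\<xi> - xhat k))\<^sup>2"

definition h_fun :: "real \<Rightarrow> real^('n::finite) \<Rightarrow> real" where
  "h_fun eps lv = eps\<^sup>2 * (vec 1 \<bullet> lv) / real CARD('n)"

text \<open>
  The maximum over \<open>\<xi>\<close> may be \<open>+\<infinity>\<close>, so it is taken as a supremum in the extended reals. It is never
  \<open>-\<infinity>\<close>, hence the sums below are free of \<open>\<infinity> - \<infinity>\<close>.
\<close>

definition objective_P ::
    "(real^'d \<Rightarrow> real^'m \<Rightarrow> real) \<Rightarrow> ('N::finite \<Rightarrow> real^'m) \<Rightarrow> real \<Rightarrow>
     real \<times> (real^('d::finite)) \<Rightarrow> ereal" where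
  "objective_P f xhat eps = (\<lambda>(l, x).
     ereal (l * eps\<^sup>2) +
     ereal (1 / real CARD('N)) *
       (\<Sum>k\<in>UNIV. SUP \<xi>\<in>(UNIV :: (real^('m::finite)) set). ereal (g_fun f xhat k x l \<xi>)))"

definition standing_assumption ::
    "(real^('d::finite) \<Rightarrow> real^'m \<Rightarrow> real) \<Rightarrow> ('N::finite \<Rightarrow> real^('m::finite)) \<Rightarrow> real \<Rightarrow> bool" where
  "standing_assumption f xhat eps \<longleftrightarrow>
     interior {(l, x). l \<ge> 0 \<and> objective_P f xhat eps (l, x) < \<infinity>} \<noteq> {} \<and>
     (\<exists>l x. is_arg_min (objective_P f xhat eps) (\<lambda>(l, x). l \<ge> 0) (l, x))"

definition objective_D ::
    "(real^'d \<Rightarrow> real^'m \<Rightarrow> real) \<Rightarrow> ('N::finite \<Rightarrow> real^'m) \<Rightarrow> ('N \<Rightarrow> 'n) \<Rightarrow> real \<Rightarrow>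
     (real^('n::finite \<times> 'd::finite)) \<times> (real^'n) \<Rightarrow> ereal" where
  "objective_D f xhat v eps = (\<lambda>(xv, lv).
     ereal (h_fun eps lv) +
     ereal (1 / real CARD('N)) *
       (\<Sum>k\<in>UNIV. SUP \<xi>\<in>(UNIV :: (real^('m::finite)) set).
          ereal (g_fun f xhat k (block xv (v k)) (lv $ v k) \<xi>)))"

definition feasible_D :: "real^'n^'n \<Rightarrow> (real^('n::finite \<times> 'd::finite)) \<times> (real^'n) \<Rightarrow> bool" where
  "feasible_D A = (\<lambda>(xv, lv).
     (\<forall>i. lv $ i \<ge> 0) \<and> laplacian A *v lv = 0 \<and> (laplacian A \<otimes>\<^sub>K (mat 1 :: real^'d^'d)) *v xv = 0)"

definition optimizer_D ::
    "real^'n^'n \<Rightarrow> (real^'d \<Rightarrow> real^'m \<Rightarrow> real) \<Rightarrow> ('N::finite \<Rightarrow> real^('m::finite)) \<Rightarrow> ('N \<Rightarrow> 'n) \<Rightarrow>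
     real \<Rightarrow> (real^('n::finite \<times> 'd::finite)) \<times> (real^'n) \<Rightarrow> bool" where
  "optimizer_D A f xhat v eps p \<longleftrightarrow> is_arg_min (objective_D f xhat v eps) (feasible_D A) p"


section \<open>The augmented Lagrangian and its saddle points\<close>

definition L_aug ::
    "real^'n^'n \<Rightarrow> (real^'d \<Rightarrow> real^'m \<Rightarrow> real) \<Rightarrow> ('N::finite \<Rightarrow> real^'m) \<Rightarrow> ('N \<Rightarrow> 'n) \<Rightarrow> real \<Rightarrow>
     real^('n::finite \<times> 'd::finite) \<Rightarrow> real^'n \<Rightarrow> real^'n \<Rightarrow> real^('n \<times> 'd) \<Rightarrow>
     real^('m::finite)^'N \<Rightarrow> real" where
  "L_aug A f xhat v eps xv lv nu eta xi =
     h_fun eps lv +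
     1 / real CARD('N) * (\<Sum>k\<in>UNIV. g_fun f xhat k (block xv (v k)) (lv $ v k) (xi $ k)) +
     nu \<bullet> (laplacian A *v lv) +
     eta \<bullet> ((laplacian A \<otimes>\<^sub>K (mat 1 :: real^'d^'d)) *v xv) +
     1/2 * (xv \<bullet> ((laplacian A \<otimes>\<^sub>K (mat 1 :: real^'d^'d)) *v xv)) +
     1/2 * (lv \<bullet> (laplacian A *v lv))"

text \<open>Minimization is in the first argument, maximization in the second.\<close>

definition saddle_point :: "('p \<Rightarrow> 'q \<Rightarrow> real) \<Rightarrow> 'p set \<Rightarrow> 'q set \<Rightarrow> 'p \<Rightarrow> 'q \<Rightarrow> bool" where
  "saddle_point \<Phi> P Q p q \<longleftrightarrow>
     p \<in> P \<and> q \<in> Q \<and> (\<forall>q'\<in>Q. \<Phi> p q' \<le> \<Phi> p q) \<and> (\<forall>p'\<in>P. \<Phi> p q \<le> \<Phi> p' q)"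

definition saddle_L_aug ::
    "real^'n^'n \<Rightarrow> (real^'d \<Rightarrow> real^'m \<Rightarrow> real) \<Rightarrow> ('N::finite \<Rightarrow> real^'m) \<Rightarrow> ('N \<Rightarrow> 'n) \<Rightarrow> real \<Rightarrow>
     ((real^('n::finite \<times> 'd::finite)) \<times> (real^'n)) set \<Rightarrow>
     (real^('n \<times> 'd)) \<times> (real^'n) \<Rightarrow> (real^'n) \<times> (real^('n \<times> 'd)) \<times> (real^('m::finite)^'N) \<Rightarrow> bool" where
  "saddle_L_aug A f xhat v eps C =
     saddle_point (\<lambda>(xv, lv) (nu, eta, xi). L_aug A f xhat v eps xv lv nu eta xi) C UNIV"


section \<open>The saddle-point dynamics\<close>

definition gradient :: "('a::real_inner \<Rightarrow> real) \<Rightarrow> 'a \<Rightarrow> 'a" where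
  "gradient \<phi> y = (THE D. GDERIV \<phi> y :> D)"

text \<open>
  \<open>is_projected_vector K y w u\<close> says that the limit \<open>\<Pi>\<^sub>K(y,w)\<close> exists and equals \<open>u\<close>. As a relation
  it leaves no spurious value where the limit does not exist, in particular for \<open>y\<close> outside the
  closed convex set \<open>K\<close>.
\<close>

definition is_projected_vector :: "'a::euclidean_space set \<Rightarrow> 'a \<Rightarrow> 'a \<Rightarrow> 'a \<Rightarrow> bool" where
  "is_projected_vector K y w u \<longleftrightarrow>
     ((\<lambda>\<delta>. (closest_point K (y + \<delta> *\<^sub>R w) - y) /\<^sub>R \<delta>) \<longlongrightarrow> u) (at_right 0)"

definition abs_continuous_on :: "real \<Rightarrow> real \<Rightarrow> (real \<Rightarrow> 'a::real_normed_vector) \<Rightarrow> bool" where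
  "abs_continuous_on a b \<gamma> \<longleftrightarrow>
     (\<forall>e>0. \<exists>r>0. \<forall>I :: (real \<times> real) set.
        finite I \<and> (\<forall>(s, t)\<in>I. a \<le> s \<and> s \<le> t \<and> t \<le> b) \<and>
        disjoint_family_on (\<lambda>(s, t). {s<..<t}) I \<and> (\<Sum>(s, t)\<in>I. t - s) < r
        \<longrightarrow> (\<Sum>(s, t)\<in>I. norm (\<gamma> t - \<gamma> s)) < e)"

text \<open>
  Caratheodory solutions on \<open>[0,\<infinity>)\<close>, absolutely continuous on each compact subinterval.
  The values of the curves at negative times are irrelevant.
\<close>

definition SP_trajectory ::
    "real^'n^'n \<Rightarrow> (real^'d \<Rightarrow> real^'m \<Rightarrow> real) \<Rightarrow> ('N::finite \<Rightarrow> real^'m) \<Rightarrow> ('N \<Rightarrow> 'n) \<Rightarrow> real \<Rightarrow>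
     ((real^('n::finite \<times> 'd::finite)) \<times> (real^'n)) set \<Rightarrow>
     (real \<Rightarrow> real^('n \<times> 'd)) \<Rightarrow> (real \<Rightarrow> real^'n) \<Rightarrow> (real \<Rightarrow> real^'n) \<Rightarrow> (real \<Rightarrow> real^('n \<times> 'd)) \<Rightarrow>
     (real \<Rightarrow> real^('m::finite)^'N) \<Rightarrow> bool" where
  "SP_trajectory A f xhat v eps C xv lv nu eta xi \<longleftrightarrow>
     (let L = L_aug A f xhat v eps in
      (\<forall>T\<ge>0. abs_continuous_on 0 T (\<lambda>t. (xv t, lv t, nu t, eta t, xi t))) \<and>
      (AE t in lebesgue. t \<ge> 0 \<longrightarrow>
         (\<exists>u. is_projected_vector C (xv t, lv t)
                 (- gradient (\<lambda>z. L z (lv t) (nu t) (eta t) (xi t)) (xv t),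
                  - gradient (\<lambda>z. L (xv t) z (nu t) (eta t) (xi t)) (lv t)) u \<and>
              ((\<lambda>s. (xv s, lv s)) has_vector_derivative u) (at t within {0..})) \<and>
         (nu has_vector_derivative
            gradient (\<lambda>z. L (xv t) (lv t) z (eta t) (xi t)) (nu t)) (at t within {0..}) \<and>
         (eta has_vector_derivative
            gradient (\<lambda>z. L (xv t) (lv t) (nu t) z (xi t)) (eta t)) (at t within {0..}) \<and>
         (\<forall>k. ((\<lambda>s. xi s $ k) has_vector_derivative
            gradient (\<lambda>z. L (xv t) (lv t) (nu t) (eta t) (\<chi> j. if j = k then z else xi t $ j))
              (xi t $ k)) (at t within {0..}))))"

end

(* Write z = (p, q) with p = (x, lambda), q = (nu, eta, xi), and let (p_S, q_S) be a saddle point with p_S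
   interior to C. Monotonicity of (grad_p L, -grad_q L) makes |z - z'|^2 nonincreasing for every saddle point
   z', and for z' = (p_S, q_S) the decrease is at least the gap L(p, q_S) - L(p_S, q) >= 0. By a Barbalat
   argument the gap tends to 0. L is quadratic in p and in xi, so the gap is an explicit sum of squares; as
   lambda_S^i > a |(x_S; 1)|^2, it forces xi -> xi_S, and the augmentation forces Lap x -> 0, Lap lambda -> 0.
   Hence nu and eta vary slowly and grad_p L - Lap (q - q_S) -> 0. If some r in C violated the variational
   inequality at a limit point, then |p - r|^2 would decrease at a fixed rate on arbitrarily long time
   windows, which boundedness excludes. So every limit point is a saddle point, and the monotone distance to
   it gives convergence. This replaces the invariance principle, which would need continuity of the flow. *)
theory Submission
  imports Defs
begin

subsection \<open>Absolutely continuous curves and projected vectors\<close>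

text \<open>The interior saddle point does two jobs: no normal cone acts on it, so
  \<open>Gp pS qS = 0\<close> and the expansion of the gap has no linear part; and its margins in
  \<open>Cset\<close> are strictly positive. Limit points of the trajectory may lie on the boundary
  of \<open>Cset\<close>, where \<open>Gp\<close> need not vanish and only a variational inequality
  can hold. When that inequality is tested, neither x nor the multipliers are known to converge;
  only \<xi>, the residuals and the Laplacian images of x and \<lambda> are. This suffices because,
  for fixed r, \<open>Gp (p t) (q t) \<bullet> (p t - r)\<close> equals
  \<open>- ((q t - qS) \<bullet> h)\<close> up to a vanishing error, with a constant h built from
  the Laplacian images of r, and this quantity is almost constant on long time windows. Solutions
  are only absolutely continuous, so every differential inequality is converted into an inequality
  between increments, without integrating derivatives.\<close>

lemma abs_continuous_nonincreasing:
  fixes \<phi> :: "real \<Rightarrow> real"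
  assumes ac: "abs_continuous_on a b \<phi>" and ab: "a \<le> b" and S: "negligible S"
    and deriv: "\<And>t. t \<in> {a..b} - S \<Longrightarrow> \<exists>D\<le>0. (\<phi> has_real_derivative D) (at t within {a..b})"
  shows "\<phi> b \<le> \<phi> a"
proof (rule field_le_epsilon)
  fix e :: real assume e: "e > 0"
  \<comment> \<open>Half of \<open>e\<close> pays for the cells tagged outside \<open>S\<close>, the
    other half for those tagged in \<open>S\<close>. The summand 1 keeps the denominator positive
    when a = b.\<close>
  define e1 where "e1 = e / (2 * (b - a + 1))"
  have e1: "e1 > 0" "e1 * (b - a) \<le> e / 2"
    using e ab by (simp_all add: e1_def field_simps)
  obtain r where r: "r > 0" and ac': "\<And>I :: (real \<times> real) set.
        finite I \<and> (\<forall>(s, t)\<in>I. a \<le> s \<and> s \<le> t \<and> t \<le> b) \<and>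
        disjoint_family_on (\<lambda>(s, t). {s<..<t}) I \<and> (\<Sum>(s, t)\<in>I. t - s) < r
        \<Longrightarrow> (\<Sum>(s, t)\<in>I. norm (\<phi> t - \<phi> s)) < e / 2"
    using ac[unfolded abs_continuous_on_def, rule_format, OF half_gt_zero[OF e]] by blast
  have Sleb: "S \<in> sets lebesgue" and Snull: "S \<in> null_sets lebesgue"
    using S by (auto simp: negligible_iff_null_sets)
  obtain U where U: "open U" "S \<subseteq> U" "U - S \<in> lmeasurable" "emeasure lebesgue (U - S) < ennreal r"
    using sets_lebesgue_outer_open[OF Sleb r] by blast
  have Ulm: "U \<in> lmeasurable"
    using U(2,3) Snull by (metis Un_Diff_cancel2 fmeasurable.Un fmeasurableI_null_sets sup.absorb1)
  have "emeasure lebesgue U = emeasure lebesgue (U - S)"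
    using Snull emeasure_Diff_null_set[OF Snull] Ulm fmeasurableD by metis
  then have Ur: "measure lebesgue U < r"
    using U(4) Ulm by (simp add: emeasure_eq_measure2 flip: ennreal_less_iff[OF measure_nonneg])
  \<comment> \<open>Straddling form of the derivative bound: u and w lie on opposite sides of t, so
    the two error terms add up to \<open>e1 * (w - u)\<close>, and the linear part is
    nonpositive.\<close>
  have "\<exists>d>0. \<forall>u\<in>{a..b}. \<forall>w\<in>{a..b}. u \<le> t \<and> t \<le> w \<and> t - u < d \<and> w - t < d \<longrightarrow> \<phi> w - \<phi> u \<le> e1 * (w - u)"
    if "t \<in> {a..b} - S" for t
  proof -
    obtain D where D: "D \<le> 0" "(\<phi> has_real_derivative D) (at t within {a..b})"
      using deriv \<open>t \<in> {a..b} - S\<close> by blast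
    then obtain d where d: "d > 0" "\<And>y. y \<in> {a..b} \<Longrightarrow> \<bar>y - t\<bar> < d \<Longrightarrow>
        \<bar>\<phi> y - \<phi> t - D * (y - t)\<bar> \<le> e1 * \<bar>y - t\<bar>"
      using e1(1) unfolding has_field_derivative_def has_derivative_within_alt by force
    show ?thesis
    proof (intro exI[of _ d] conjI ballI impI d(1))
      fix u w assume uw: "u \<in> {a..b}" "w \<in> {a..b}" "u \<le> t \<and> t \<le> w \<and> t - u < d \<and> w - t < d"
      have "D * (w - u) \<le> 0" using D(1) uw by (simp add: mult_nonpos_nonneg)
      moreover have "\<bar>\<phi> u - \<phi> t - D * (u - t)\<bar> \<le> e1 * (t - u)" "\<bar>\<phi> w - \<phi> t - D * (w - t)\<bar> \<le> e1 * (w - t)"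
        using d(2)[of u] d(2)[of w] uw by (auto simp: abs_minus_commute)
      ultimately show "\<phi> w - \<phi> u \<le> e1 * (w - u)"
        by (simp add: algebra_simps abs_le_iff)
    qed
  qed
  then have "\<forall>t\<in>{a..b} - S. \<exists>d. d > 0 \<and>
      (\<forall>u\<in>{a..b}. \<forall>w\<in>{a..b}. u \<le> t \<and> t \<le> w \<and> t - u < d \<and> w - t < d \<longrightarrow> \<phi> w - \<phi> u \<le> e1 * (w - u))"
    by (intro ballI) presburger
  from bchoice[OF this] obtain d where d0: "\<forall>t\<in>{a..b} - S. d t > 0 \<and>
      (\<forall>u\<in>{a..b}. \<forall>w\<in>{a..b}. u \<le> t \<and> t \<le> w \<and> t - u < d t \<and> w - t < d t \<longrightarrow> \<phi> w - \<phi> u \<le> e1 * (w - u))"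
    by (elim exE)
  have d: "d t > 0" if "t \<in> {a..b} - S" for t
    using d0 that by (elim ballE) auto
  have d': "\<phi> w - \<phi> u \<le> e1 * (w - u)"
    if "t \<in> {a..b} - S" "u \<in> {a..b}" "w \<in> {a..b}" "u \<le> t" "t \<le> w" "t - u < d t" "w - t < d t" for t u w
    using bspec[OF d0 that(1)] that(2-) by simp
  \<comment> \<open>Tags outside \<open>S\<close> are controlled by the derivative; cells tagged in \<open>S\<close> lie in \<open>U\<close>, so their total
    length is below \<open>r\<close> and absolute continuity applies.\<close>
  define g where "g t = (if t \<in> S then U else ball t (if t \<in> {a..b} then d t else 1))" for t
  have "gauge g"
    unfolding gauge_def g_def using U(1,2) d by auto
  then obtain P where P: "P tagged_division_of {a..b}" "g fine P"
    using fine_division_exists_real by blast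
  have finP: "finite P" using P(1) by auto
  have K: "\<exists>u w. K = {u..w} \<and> a \<le> u \<and> u \<le> t \<and> t \<le> w \<and> w \<le> b \<and> Inf K = u \<and> Sup K = w" if tK: "(t, K) \<in> P" for t K
  proof -
    from tagged_division_ofD(2-4)[OF P(1) tK] obtain u w where "K = {u..w}" "t \<in> K" "K \<subseteq> {a..b}"
      by auto
    then show ?thesis by (intro exI[of _ u] exI[of _ w]) auto
  qed
  \<comment> \<open>One-point cells have zero increment. Removing them leaves cells with nonempty
    interior, so that disjointness of interiors makes both the cells and their endpoint pairs
    distinct.\<close>
  define B where "B = {x\<in>P. fst x \<in> S \<and> interior (snd x) \<noteq> {}}"
  define Z where "Z = {x\<in>P. fst x \<in> S \<and> interior (snd x) = {}}"
  define G where "G = {x\<in>P. fst x \<notin> S}"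
  have fin: "finite B" "finite Z" "finite G" using finP by (auto simp: B_def Z_def G_def)
  have PU: "P = (B \<union> Z) \<union> G" "B \<inter> Z = {}" "(B \<union> Z) \<inter> G = {}" by (auto simp: B_def Z_def G_def)
  let ?F = "\<lambda>(x::real, K). \<phi> (Sup K) - \<phi> (Inf K)"
  have "\<phi> b - \<phi> a = sum ?F P"
    by (rule additive_tagged_division_1[OF ab P(1), symmetric])
  also have "\<dots> = sum ?F B + sum ?F Z + sum ?F G"
    by (subst PU(1), subst sum.union_disjoint) (use fin PU in \<open>auto simp: sum.union_disjoint\<close>)
  also have "sum ?F Z = 0"
  proof (rule sum.neutral, clarify)
    fix t K assume tK: "(t, K) \<in> Z"
    then obtain u w where "K = {u..w}" "u \<le> w" "Inf K = u" "Sup K = w"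
      using K[of t K] by (auto simp: Z_def)
    with tK show "\<phi> (Sup K) - \<phi> (Inf K) = 0"
      by (auto simp: Z_def interior_atLeastAtMost_real)
  qed
  also have "sum ?F G \<le> (\<Sum>(x, K)\<in>G. e1 * (Sup K - Inf K))"
  proof (rule sum_mono, clarify)
    fix t K assume tK: "(t, K) \<in> G"
    then obtain u w where uw: "K = {u..w}" "a \<le> u" "u \<le> t" "t \<le> w" "w \<le> b" "Inf K = u" "Sup K = w"
      using K[of t K] by (auto simp: G_def)
    have "K \<subseteq> g t" using P(2) tK by (auto simp: G_def fine_def)
    then have "u \<in> ball t (d t)" "w \<in> ball t (d t)"
      using uw tK by (auto simp: g_def G_def subset_iff split: if_splits)
    then show "\<phi> (Sup K) - \<phi> (Inf K) \<le> e1 * (Sup K - Inf K)"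
      using uw tK by (auto simp: G_def dist_real_def intro!: d'[of t])
  qed
  also have "\<dots> \<le> (\<Sum>(x, K)\<in>P. e1 * (Sup K - Inf K))"
  proof (rule sum_mono2[OF finP])
    fix x assume x: "x \<in> P - G"
    obtain t K where tK: "x = (t, K)" by (cases x)
    obtain u w where "u \<le> t" "t \<le> w" "Inf K = u" "Sup K = w"
      using K[of t K] x tK by auto
    then show "0 \<le> (case x of (x, K) \<Rightarrow> e1 * (Sup K - Inf K))" using e1(1) tK by simp
  qed (auto simp: G_def)
  also have "\<dots> = e1 * (\<Sum>(x, K)\<in>P. Sup K - Inf K)"
    by (simp add: sum_distrib_left case_prod_unfold)
  also have "\<dots> = e1 * (b - a)"
    by (simp only: additive_tagged_division_1[OF ab P(1), where f = "\<lambda>x. x"])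
  finally have 1: "\<phi> b - \<phi> a \<le> sum ?F B + e1 * (b - a)" by simp
  have pt: "B tagged_partial_division_of {a..b}"
    using P(1) tagged_partial_division_subset[of P "{a..b}" B]
    by (auto simp: B_def tagged_division_of_def)
  let ?h = "\<lambda>(x::real, K::real set). (Inf K, Sup K)"
  have BK: "\<exists>u w. K = {u..w} \<and> a \<le> u \<and> u \<le> t \<and> t \<le> w \<and> w \<le> b \<and> Inf K = u \<and> Sup K = w \<and> u < w" if "(t, K) \<in> B" for t K
  proof -
    from that obtain u w where uw: "K = {u..w}" "a \<le> u" "u \<le> t" "t \<le> w" "w \<le> b" "Inf K = u" "Sup K = w"
      using K[of t K] by (auto simp: B_def)
    moreover have "u < w"
      using that uw by (auto simp: B_def interior_atLeastAtMost_real)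
    ultimately show ?thesis by blast
  qed
  have disj: "interior K1 \<inter> interior K2 = {}" if "(x1, K1) \<in> B" "(x2, K2) \<in> B" "(x1, K1) \<noteq> (x2, K2)" for x1 K1 x2 K2
    using tagged_division_ofD(5)[OF P(1), of x1 K1 x2 K2] that unfolding B_def by blast
  have inj: "inj_on ?h B"
  proof (rule inj_onI, clarify, rule ccontr)
    fix x1 K1 x2 K2
    assume *: "(x1, K1) \<in> B" "(x2, K2) \<in> B" "Inf K1 = Inf K2" "Sup K1 = Sup K2" "\<not> (x1 = x2 \<and> K1 = K2)"
    then have "K1 = K2" using BK[OF *(1)] BK[OF *(2)] by auto
    moreover have "interior K1 \<inter> interior K2 = {}" using disj[OF *(1,2)] *(5) by blast
    ultimately show False using *(1) by (auto simp: B_def)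
  qed
  have sums: "(\<Sum>(s, t)\<in>?h ` B. H s t) = (\<Sum>(x, K)\<in>B. H (Inf K) (Sup K))" for H :: "real \<Rightarrow> real \<Rightarrow> real"
    by (subst sum.reindex[OF inj]) (simp add: case_prod_unfold o_def)
  have "(\<Sum>(x, K)\<in>B. Sup K - Inf K) = (\<Sum>(x, K)\<in>B. measure lebesgue K)"
  proof (rule sum.cong[OF refl], clarify)
    fix t K assume "(t, K) \<in> B"
    from BK[OF this] obtain u w where "K = {u..w}" "u < w" by blast
    then show "Sup K - Inf K = measure lebesgue K" by simp
  qed
  also have "\<dots> = sum (measure lebesgue) (snd ` B)"
  proof -
    have "inj_on snd B"
    proof (rule inj_onI, rule ccontr)
      fix x y assume *: "x \<in> B" "y \<in> B" "snd x = snd y" "x \<noteq> y"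
      then have "interior (snd x) \<inter> interior (snd y) = {}"
        using disj[OF _ _ , of "fst x" "snd x" "fst y" "snd y"] by (cases x, cases y) auto
      with * show False by (simp add: B_def)
    qed
    then show ?thesis by (simp add: sum.reindex case_prod_unfold)
  qed
  also have "\<dots> = measure lebesgue (\<Union>(snd ` B))"
    using content_division[OF partial_division_of_tagged_division[OF pt]] by simp
  also have "\<dots> \<le> measure lebesgue U"
  proof (rule measure_mono_fmeasurable[OF _ _ Ulm])
    show "\<Union>(snd ` B) \<subseteq> U"
    proof
      fix x assume "x \<in> \<Union>(snd ` B)"
      then obtain t K where "x \<in> K" "(t, K) \<in> B" by auto
      then have "(t, K) \<in> P" "t \<in> S" by (auto simp: B_def)
      then have "K \<subseteq> g t" using P(2) unfolding fine_def by blast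
      then show "x \<in> U" using \<open>x \<in> K\<close> \<open>t \<in> S\<close> by (auto simp: g_def)
    qed
    show "\<Union>(snd ` B) \<in> sets lebesgue"
      by (rule fmeasurableD[OF lmeasurable_division[OF partial_division_of_tagged_division[OF pt]]])
  qed
  finally have len: "(\<Sum>(s, t)\<in>?h ` B. t - s) < r" using Ur by (subst sums) simp
  have "(\<Sum>(s, t)\<in>?h ` B. norm (\<phi> t - \<phi> s)) < e / 2"
  proof (rule ac', intro conjI len)
    show "finite (?h ` B)" using fin by simp
    show "\<forall>(s, t)\<in>?h ` B. a \<le> s \<and> s \<le> t \<and> t \<le> b"
    proof
      fix i assume "i \<in> ?h ` B"
      then obtain t K where i: "i = (Inf K, Sup K)" "(t, K) \<in> B" by auto
      from BK[OF i(2)] show "case i of (s, t) \<Rightarrow> a \<le> s \<and> s \<le> t \<and> t \<le> b" unfolding i(1) by auto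
    qed
    show "disjoint_family_on (\<lambda>(s, t). {s<..<t}) (?h ` B)"
      unfolding disjoint_family_on_def
    proof (intro ballI impI)
      fix I1 I2 assume *: "I1 \<in> ?h ` B" "I2 \<in> ?h ` B" "I1 \<noteq> I2"
      then obtain x1 K1 x2 K2 where I: "I1 = (Inf K1, Sup K1)" "I2 = (Inf K2, Sup K2)"
          "(x1, K1) \<in> B" "(x2, K2) \<in> B" by auto
      with *(3) have "interior K1 \<inter> interior K2 = {}" by (intro disj) auto
      moreover obtain u1 w1 where "K1 = {u1..w1}" "u1 < w1" using BK[OF I(3)] by blast
      moreover obtain u2 w2 where "K2 = {u2..w2}" "u2 < w2" using BK[OF I(4)] by blast
      ultimately show "(case I1 of (s, t) \<Rightarrow> {s<..<t}) \<inter> (case I2 of (s, t) \<Rightarrow> {s<..<t}) = {}"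
        unfolding I by (simp add: interior_atLeastAtMost_real)
    qed
  qed
  moreover have "sum ?F B \<le> (\<Sum>(s, t)\<in>?h ` B. norm (\<phi> t - \<phi> s))"
    by (subst sums) (auto intro!: sum_mono)
  ultimately show "\<phi> b \<le> \<phi> a + e" using 1 e1(2) by linarith
qed

text \<open>Transfers absolute continuity from the trajectory to scalar functions of it; the term
  with \<open>M\<close> accommodates a subtracted linear drift.\<close>

lemma abs_continuous_on_dominated:
  fixes \<gamma> :: "real \<Rightarrow> 'a::real_normed_vector" and \<phi> :: "real \<Rightarrow> 'b::real_normed_vector"
  assumes ac: "abs_continuous_on a b \<gamma>"
    and dom: "\<And>s t. a \<le> s \<Longrightarrow> s \<le> t \<Longrightarrow> t \<le> b \<Longrightarrow> norm (\<phi> t - \<phi> s) \<le> K * norm (\<gamma> t - \<gamma> s) + M * (t - s)"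
  shows "abs_continuous_on a b \<phi>"
  unfolding abs_continuous_on_def
proof (intro allI impI)
  fix e :: real assume e: "e > 0"
  define K' M' where "K' = max K 0 + 1" "M' = max M 0 + 1"
  have KM: "K' > 0" "M' > 0" "K \<le> K'" "M \<le> M'" by (auto simp: K'_M'_def)
  have eK: "e / (2 * K') > 0" using e KM(1) by simp
  obtain r where r: "r > 0" and ac': "\<And>I :: (real \<times> real) set.
        finite I \<and> (\<forall>(s, t)\<in>I. a \<le> s \<and> s \<le> t \<and> t \<le> b) \<and>
        disjoint_family_on (\<lambda>(s, t). {s<..<t}) I \<and> (\<Sum>(s, t)\<in>I. t - s) < r
        \<Longrightarrow> (\<Sum>(s, t)\<in>I. norm (\<gamma> t - \<gamma> s)) < e / (2 * K')"
    using ac[unfolded abs_continuous_on_def, rule_format, OF eK] by blast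
  show "\<exists>r>0. \<forall>I :: (real \<times> real) set.
        finite I \<and> (\<forall>(s, t)\<in>I. a \<le> s \<and> s \<le> t \<and> t \<le> b) \<and>
        disjoint_family_on (\<lambda>(s, t). {s<..<t}) I \<and> (\<Sum>(s, t)\<in>I. t - s) < r
        \<longrightarrow> (\<Sum>(s, t)\<in>I. norm (\<phi> t - \<phi> s)) < e"
  proof (intro exI[of _ "min r (e / (2 * M'))"] conjI allI impI)
    fix I :: "(real \<times> real) set"
    assume I: "finite I \<and> (\<forall>(s, t)\<in>I. a \<le> s \<and> s \<le> t \<and> t \<le> b) \<and>
        disjoint_family_on (\<lambda>(s, t). {s<..<t}) I \<and> (\<Sum>(s, t)\<in>I. t - s) < min r (e / (2 * M'))"
    have "(\<Sum>(s, t)\<in>I. norm (\<phi> t - \<phi> s)) \<le> (\<Sum>(s, t)\<in>I. K' * norm (\<gamma> t - \<gamma> s) + M' * (t - s))"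
    proof (rule sum_mono, clarify)
      fix s t assume "(s, t) \<in> I"
      then have st: "a \<le> s" "s \<le> t" "t \<le> b" using I by auto
      have "K * norm (\<gamma> t - \<gamma> s) \<le> K' * norm (\<gamma> t - \<gamma> s)" "M * (t - s) \<le> M' * (t - s)"
        using KM st by (auto intro: mult_right_mono)
      then show "norm (\<phi> t - \<phi> s) \<le> K' * norm (\<gamma> t - \<gamma> s) + M' * (t - s)"
        using dom[OF st] by linarith
    qed
    also have "\<dots> = K' * (\<Sum>(s, t)\<in>I. norm (\<gamma> t - \<gamma> s)) + M' * (\<Sum>(s, t)\<in>I. t - s)"
      by (simp add: sum.distrib sum_distrib_left case_prod_unfold)
    also have "\<dots> < K' * (e / (2 * K')) + M' * (e / (2 * M'))"
      using ac'[of I] I KM(1,2) by (intro add_strict_mono mult_strict_left_mono) simp_all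
    also have "\<dots> = e" using KM by simp
    finally show "(\<Sum>(s, t)\<in>I. norm (\<phi> t - \<phi> s)) < e" .
  qed (use r e KM in auto)
qed

lemma abs_continuous_on_imp_continuous_on:
  assumes ac: "abs_continuous_on a b \<gamma>"
  shows "continuous_on {a..b} \<gamma>"
  unfolding continuous_on_iff
proof (intro ballI allI impI)
  fix x e :: real assume x: "x \<in> {a..b}" and e: "e > 0"
  obtain r where r: "r > 0" and ac': "\<And>I :: (real \<times> real) set.
        finite I \<and> (\<forall>(s, t)\<in>I. a \<le> s \<and> s \<le> t \<and> t \<le> b) \<and>
        disjoint_family_on (\<lambda>(s, t). {s<..<t}) I \<and> (\<Sum>(s, t)\<in>I. t - s) < r
        \<Longrightarrow> (\<Sum>(s, t)\<in>I. norm (\<gamma> t - \<gamma> s)) < e"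
    using ac[unfolded abs_continuous_on_def, rule_format, OF e] by blast
  show "\<exists>d>0. \<forall>x'\<in>{a..b}. dist x' x < d \<longrightarrow> dist (\<gamma> x') (\<gamma> x) < e"
  proof (intro exI[of _ r] conjI ballI impI r)
    fix y assume y: "y \<in> {a..b}" "dist y x < r"
    show "dist (\<gamma> y) (\<gamma> x) < e"
      using ac'[of "{(min x y, max x y)}"] x y
      by (cases "x \<le> y") (auto simp: disjoint_family_on_def dist_norm dist_real_def norm_minus_commute)
  qed
qed

lemma abs_continuous_on_subset:
  assumes "abs_continuous_on a b \<gamma>" "a \<le> a'" "b' \<le> b"
  shows "abs_continuous_on a' b' \<gamma>"
  unfolding abs_continuous_on_def
proof (intro allI impI)
  fix e :: real assume "e > 0"
  from assms(1)[unfolded abs_continuous_on_def, rule_format, OF this] obtain r where r: "r > 0"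
    and ac: "\<And>I :: (real \<times> real) set. finite I \<and> (\<forall>(s, t)\<in>I. a \<le> s \<and> s \<le> t \<and> t \<le> b) \<and>
        disjoint_family_on (\<lambda>(s, t). {s<..<t}) I \<and> (\<Sum>(s, t)\<in>I. t - s) < r
        \<Longrightarrow> (\<Sum>(s, t)\<in>I. norm (\<gamma> t - \<gamma> s)) < e"
    by blast
  have "(\<Sum>(s, t)\<in>I. norm (\<gamma> t - \<gamma> s)) < e"
    if I: "finite I \<and> (\<forall>(s, t)\<in>I. a' \<le> s \<and> s \<le> t \<and> t \<le> b') \<and>
        disjoint_family_on (\<lambda>(s, t). {s<..<t}) I \<and> (\<Sum>(s, t)\<in>I. t - s) < r" for I :: "(real \<times> real) set"
  proof (rule ac, intro conjI)
    show "\<forall>(s, t)\<in>I. a \<le> s \<and> s \<le> t \<and> t \<le> b"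
      using I assms(2,3) by fastforce
  qed (use I in auto)
  with r show "\<exists>r>0. \<forall>I :: (real \<times> real) set.
        finite I \<and> (\<forall>(s, t)\<in>I. a' \<le> s \<and> s \<le> t \<and> t \<le> b') \<and>
        disjoint_family_on (\<lambda>(s, t). {s<..<t}) I \<and> (\<Sum>(s, t)\<in>I. t - s) < r
        \<longrightarrow> (\<Sum>(s, t)\<in>I. norm (\<gamma> t - \<gamma> s)) < e"
    by blast
qed

text \<open>A finite limit of the quotient forces its numerator to 0, so y is a limit of closest
  points. Thus the differential equation itself places the state in K at almost every time.\<close>

lemma is_projected_vector_imp_mem:
  assumes K: "closed K" "K \<noteq> {}" and u: "is_projected_vector K y w u"
  shows "y \<in> K"
proof -
  have "((\<lambda>\<delta>::real. y + \<delta> *\<^sub>R ((closest_point K (y + \<delta> *\<^sub>R w) - y) /\<^sub>R \<delta>)) \<longlongrightarrow> y + 0 *\<^sub>R u) (at_right 0)"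
    by (intro tendsto_intros u[unfolded is_projected_vector_def])
  moreover have "\<forall>\<^sub>F \<delta> in at_right 0. y + \<delta> *\<^sub>R ((closest_point K (y + \<delta> *\<^sub>R w) - y) /\<^sub>R \<delta>)
      = closest_point K (y + \<delta> *\<^sub>R w)"
    by (rule eventually_mono[OF eventually_at_right_less]) auto
  ultimately have "((\<lambda>\<delta>::real. closest_point K (y + \<delta> *\<^sub>R w)) \<longlongrightarrow> y + 0 *\<^sub>R u) (at_right 0)"
    by (rule Lim_transform_eventually)
  then show ?thesis
    using Lim_in_closed_set[OF K(1), of "\<lambda>\<delta>. closest_point K (y + \<delta> *\<^sub>R w)" "at_right 0"]
    by (auto simp: closest_point_in_set[OF K])
qed

text \<open>The obtuse-angle inequality for the closest point to y + \<delta> w, divided by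
  \<delta>, passes to the limit: w - u lies in the normal cone of K at y.\<close>

lemma is_projected_vector_normal:
  assumes K: "closed K" "convex K" "y \<in> K" "r \<in> K" and u: "is_projected_vector K y w u"
  shows "(w - u) \<bullet> (r - y) \<le> 0"
proof -
  let ?c = "\<lambda>\<delta>. closest_point K (y + \<delta> *\<^sub>R w)"
  let ?u = "\<lambda>\<delta>. (?c \<delta> - y) /\<^sub>R \<delta>"
  have lim: "((\<lambda>\<delta>. (w - ?u \<delta>) \<bullet> (r - (y + \<delta> *\<^sub>R ?u \<delta>))) \<longlongrightarrow> (w - u) \<bullet> (r - (y + 0 *\<^sub>R u))) (at_right 0)"
    by (intro tendsto_intros u[unfolded is_projected_vector_def])
  have "(w - ?u \<delta>) \<bullet> (r - (y + \<delta> *\<^sub>R ?u \<delta>)) \<le> 0" if "\<delta> > 0" for \<delta> :: real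
  proof -
    have "(y + \<delta> *\<^sub>R w - ?c \<delta>) \<bullet> (r - ?c \<delta>) \<le> 0"
      by (rule closest_point_dot) (use K in auto)
    moreover have "y + \<delta> *\<^sub>R w - ?c \<delta> = \<delta> *\<^sub>R (w - ?u \<delta>)" "y + \<delta> *\<^sub>R ?u \<delta> = ?c \<delta>"
      using that by (auto simp: algebra_simps)
    ultimately have "\<delta> * ((w - ?u \<delta>) \<bullet> (r - (y + \<delta> *\<^sub>R ?u \<delta>))) \<le> 0"
      by (metis inner_scaleR_left)
    then show ?thesis using that by (simp add: mult_le_0_iff)
  qed
  then have "\<forall>\<^sub>F \<delta> in at_right 0. (w - ?u \<delta>) \<bullet> (r - (y + \<delta> *\<^sub>R ?u \<delta>)) \<le> 0"
    by (intro eventually_mono[OF eventually_at_right_less])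
  from tendsto_upperbound[OF lim this] show ?thesis by simp
qed

text \<open>The projection is nonexpansive and fixes y, so projecting cannot increase the
  speed.\<close>

lemma is_projected_vector_norm_le:
  assumes K: "closed K" "convex K" "y \<in> K" and u: "is_projected_vector K y w u"
  shows "norm u \<le> norm w"
proof -
  have lim: "((\<lambda>\<delta>. norm ((closest_point K (y + \<delta> *\<^sub>R w) - y) /\<^sub>R \<delta>)) \<longlongrightarrow> norm u) (at_right 0)"
    by (intro tendsto_intros u[unfolded is_projected_vector_def])
  have "norm ((closest_point K (y + \<delta> *\<^sub>R w) - y) /\<^sub>R \<delta>) \<le> norm w" if "\<delta> > 0" for \<delta> :: real
  proof -
    have "dist (closest_point K (y + \<delta> *\<^sub>R w)) (closest_point K y) \<le> dist (y + \<delta> *\<^sub>R w) y"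
      by (rule closest_point_lipschitz) (use K in auto)
    then show ?thesis
      using that by (simp add: closest_point_self[OF K(3)] dist_norm pos_divide_le_eq divide_inverse_commute[symmetric] mult.commute)
  qed
  then have "\<forall>\<^sub>F \<delta> in at_right 0. norm ((closest_point K (y + \<delta> *\<^sub>R w) - y) /\<^sub>R \<delta>) \<le> norm w"
    by (intro eventually_mono[OF eventually_at_right_less])
  from tendsto_upperbound[OF lim this] show ?thesis by simp
qed

subsection \<open>Projected saddle-point flows\<close>

text \<open>One-sided Barbalat argument, in which \<open>growth\<close> says without derivatives
  that y grows at rate at most g. By uniform continuity a dip of g to -e persists below -e/2 for a
  time d, and this costs y more than its convergence allows.\<close>

lemma barbalat_lower:
  fixes g y :: "real \<Rightarrow> real"
  assumes lim: "(y \<longlongrightarrow> l) at_top" and e: "e > 0"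
    and uc: "\<And>e. e > 0 \<Longrightarrow> \<exists>d>0. \<forall>s\<ge>0. \<forall>t\<ge>0. \<bar>s - t\<bar> \<le> d \<longrightarrow> \<bar>g s - g t\<bar> < e"
    and growth: "\<And>a b c. 0 \<le> a \<Longrightarrow> a \<le> b \<Longrightarrow> \<forall>t\<in>{a..b}. g t \<le> c \<Longrightarrow> y b - y a \<le> c * (b - a)"
  shows "\<forall>\<^sub>F t in at_top. g t > - e"
proof -
  obtain d where d: "d > 0" "\<And>s t. s \<ge> 0 \<Longrightarrow> t \<ge> 0 \<Longrightarrow> \<bar>s - t\<bar> \<le> d \<Longrightarrow> \<bar>g s - g t\<bar> < e / 2"
    using uc[of "e/2"] e by auto
  \<comment> \<open>Two values this close to l differ by less than \<open>e * d / 2\<close>, which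
    is the drop that a dip would force.\<close>
  have "\<forall>\<^sub>F t in at_top. dist (y t) l < e * d / 4"
    using e d(1) by (intro tendstoD[OF lim]) simp
  then obtain T where T: "\<And>t. t \<ge> T \<Longrightarrow> dist (y t) l < e * d / 4"
    by (auto simp: eventually_at_top_linorder)
  have "g t > - e" if t: "t \<ge> max T 0" for t
  proof (rule ccontr)
    assume "\<not> g t > - e"
    have "g s \<le> - (e / 2)" if "s \<in> {t..t+d}" for s
    proof -
      have "\<bar>g t - g s\<bar> < e / 2" using d(2)[of t s] t that by simp
      then show ?thesis using \<open>\<not> g t > - e\<close> by linarith
    qed
    then have "\<forall>s\<in>{t..t+d}. g s \<le> - (e / 2)" by blast
    from growth[OF _ _ this] t d(1) have "y (t + d) - y t \<le> - (e / 2) * d" by simp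
    moreover have "\<bar>y t - l\<bar> < e * d / 4" "\<bar>y (t + d) - l\<bar> < e * d / 4"
      using T[of t] T[of "t + d"] t d(1) by (simp_all add: dist_real_def)
    ultimately show False by linarith
  qed
  then show ?thesis unfolding eventually_at_top_linorder by blast
qed

lemma half_norm_sq_lipschitz:
  fixes x y :: "'a::real_inner"
  assumes "norm x \<le> B" "norm y \<le> B"
  shows "\<bar>(norm x)\<^sup>2 / 2 - (norm y)\<^sup>2 / 2\<bar> \<le> B * norm (x - y)"
proof -
  have "(norm x)\<^sup>2 - (norm y)\<^sup>2 = (x + y) \<bullet> (x - y)"
    by (simp add: power2_norm_eq_inner algebra_simps inner_commute)
  also have "\<bar>\<dots>\<bar> \<le> norm (x + y) * norm (x - y)" by (rule Cauchy_Schwarz_ineq2)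
  also have "\<dots> \<le> (2 * B) * norm (x - y)"
    using norm_triangle_ineq[of x y] assms by (intro mult_right_mono) auto
  finally show ?thesis by simp
qed

lemma has_real_derivative_half_norm_sq:
  fixes f :: "real \<Rightarrow> 'a::real_inner"
  assumes "(f has_vector_derivative f') (at t within S)"
  shows "((\<lambda>t. (norm (f t - r))\<^sup>2 / 2) has_real_derivative f' \<bullet> (f t - r)) (at t within S)"
proof -
  have "((\<lambda>t. (1/2) * ((f t - r) \<bullet> (f t - r))) has_derivative (\<lambda>h. (1/2) * ((f t - r) \<bullet> (h *\<^sub>R f') + (h *\<^sub>R f') \<bullet> (f t - r)))) (at t within S)"
    by (intro has_derivative_mult_right has_derivative_inner
        has_derivative_diff[OF assms[unfolded has_vector_derivative_def] has_derivative_const, simplified])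
  moreover have "(\<lambda>h. (1/2) * ((f t - r) \<bullet> (h *\<^sub>R f') + (h *\<^sub>R f') \<bullet> (f t - r))) = (*) (f' \<bullet> (f t - r))"
    by (auto simp: inner_commute)
  ultimately show ?thesis
    by (simp add: has_field_derivative_def power2_norm_eq_inner)
qed

lemma has_real_derivative_inner:
  fixes f :: "real \<Rightarrow> 'a::real_inner"
  assumes "(f has_vector_derivative f') (at t within S)"
  shows "((\<lambda>t. f t \<bullet> h) has_real_derivative f' \<bullet> h) (at t within S)"
  using has_derivative_inner_left[OF assms[unfolded has_vector_derivative_def], of h]
  by (simp add: has_field_derivative_def mult.commute[of _ "f' \<bullet> h"])

text \<open>The projection enters only through the normal-cone inequality and the speed bound, so
  the flow argument never mentions closest points. Concavity in q is required only over
  \<open>C\<close>, since the regression Lagrangian is concave in \<xi> only where the multipliers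
  dominate.\<close>

locale projected_saddle_flow =
  fixes C :: "'p::euclidean_space set" and L :: "'p \<Rightarrow> 'q::euclidean_space \<Rightarrow> real"
    and Gp :: "'p \<Rightarrow> 'q \<Rightarrow> 'p" and Gq :: "'p \<Rightarrow> 'q \<Rightarrow> 'q"
    and p :: "real \<Rightarrow> 'p" and q :: "real \<Rightarrow> 'q" and S :: "real set"
  assumes closed_C: "closed C"
    and convex_L: "\<And>r x y. r \<in> C \<Longrightarrow> x \<in> C \<Longrightarrow> Gp x y \<bullet> (r - x) \<le> L r y - L x y"
    and concave_L: "\<And>x y s. x \<in> C \<Longrightarrow> L x s - L x y \<le> Gq x y \<bullet> (s - y)"
    and cont_L: "continuous_on UNIV (\<lambda>z. L (fst z) (snd z))"
    and cont_Gp: "continuous_on UNIV (\<lambda>z. Gp (fst z) (snd z))"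
    and cont_Gq: "continuous_on UNIV (\<lambda>z. Gq (fst z) (snd z))"
    and ac: "\<And>T. T \<ge> 0 \<Longrightarrow> abs_continuous_on 0 T (\<lambda>t. (p t, q t))"
    and negligible_S: "negligible S"
    and mem_ae: "\<And>t. t \<ge> 0 \<Longrightarrow> t \<notin> S \<Longrightarrow> p t \<in> C"
    and deriv_p: "\<And>t. t \<ge> 0 \<Longrightarrow> t \<notin> S \<Longrightarrow> \<exists>u. (p has_vector_derivative u) (at t within {0..}) \<and>
           (\<forall>r\<in>C. (- Gp (p t) (q t) - u) \<bullet> (r - p t) \<le> 0) \<and> norm u \<le> norm (Gp (p t) (q t))"
    and deriv_q: "\<And>t. t \<ge> 0 \<Longrightarrow> t \<notin> S \<Longrightarrow> (q has_vector_derivative Gq (p t) (q t)) (at t within {0..})"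
begin

lemma continuous_flow: "continuous_on {a..b} (\<lambda>t. (p t, q t))" if "a \<ge> 0"
proof (cases "b \<ge> 0")
  case True
  show ?thesis
    by (rule continuous_on_subset[OF abs_continuous_on_imp_continuous_on[OF ac[OF True]]]) (use that in auto)
qed (use that in auto)

text \<open>Times outside a null set are dense, and membership passes to the limit by continuity and
  closedness. The approximating times lie to the right of t so that t = 0 is covered.\<close>

lemma mem: "p t \<in> C" if t: "t \<ge> 0"
proof -
  have "\<exists>s. s \<in> {t..t + 1 / real (Suc n)} - S" for n
  proof (rule ccontr)
    assume "\<not> ?thesis"
    then have "negligible {t..t + 1 / real (Suc n)}"
      by (intro negligible_subset[OF negligible_S]) auto
    then show False
      using negligible_interval(1)[of t "t + 1 / real (Suc n)"] by simp
  qed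
  then obtain s where s: "\<And>n. s n \<in> {t..t + 1 / real (Suc n)} - S" by metis
  have "s \<longlonglongrightarrow> t"
  proof (rule tendsto_sandwich[of "\<lambda>_. t" _ _ "\<lambda>n. t + 1 / real (Suc n)"])
    show "(\<lambda>n. t + 1 / real (Suc n)) \<longlonglongrightarrow> t"
      using tendsto_add[OF tendsto_const LIMSEQ_Suc[OF lim_1_over_n], of t] by simp
  qed (use s in \<open>auto intro!: always_eventually\<close>)
  moreover have "s n \<in> {t..t+1}" for n
  proof -
    have "1 / real (Suc n) \<le> 1" by simp
    moreover have "t \<le> s n" "s n \<le> t + 1 / real (Suc n)" using s[of n] by (simp_all del: of_nat_Suc)
    ultimately have "t \<le> s n" "s n \<le> t + 1" by linarith+
    then show ?thesis by simp
  qed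
  ultimately have "(\<lambda>n. (p (s n), q (s n))) \<longlonglongrightarrow> (p t, q t)"
    using continuous_flow[OF t, of "t+1"] unfolding continuous_on_sequentially comp_def by auto
  then have "(\<lambda>n. p (s n)) \<longlonglongrightarrow> p t" by (auto dest: tendsto_fst)
  moreover have "p (s n) \<in> C" for n
    using s[of n] t by (intro mem_ae) auto
  ultimately show ?thesis
    by (rule Lim_in_closed_set[OF closed_C always_eventually[OF allI] sequentially_bot, rotated])
qed

text \<open>The Lipschitz bound along the trajectory makes \<phi> absolutely continuous, so the
  monotonicity lemma applies to \<phi> t - c t. All differential inequalities below are used in this
  incremental form.\<close>

lemma growth_bound:
  fixes \<phi> :: "real \<Rightarrow> real"
  assumes ab: "0 \<le> a" "a \<le> b"
    and lip: "\<And>s t. s \<in> {a..b} \<Longrightarrow> t \<in> {a..b} \<Longrightarrow> \<bar>\<phi> t - \<phi> s\<bar> \<le> K * norm ((p t, q t) - (p s, q s))"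
    and deriv: "\<And>t. t \<in> {a..b} - S \<Longrightarrow> \<exists>D\<le>c. (\<phi> has_real_derivative D) (at t within {0..})"
  shows "\<phi> b - \<phi> a \<le> c * (b - a)"
proof -
  have "abs_continuous_on a b (\<lambda>t. \<phi> t - c * t)"
  proof (rule abs_continuous_on_dominated[where K = K and M = "\<bar>c\<bar>"])
    show "abs_continuous_on a b (\<lambda>t. (p t, q t))"
      by (rule abs_continuous_on_subset[OF ac[of b]]) (use ab in auto)
    fix s t assume st: "a \<le> s" "s \<le> t" "t \<le> b"
    have "\<bar>(\<phi> t - c * t) - (\<phi> s - c * s)\<bar> \<le> \<bar>\<phi> t - \<phi> s\<bar> + \<bar>c * (t - s)\<bar>"
      using abs_triangle_ineq4[of "\<phi> t - \<phi> s" "c * (t - s)"] by (simp add: algebra_simps)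
    then show "norm ((\<phi> t - c * t) - (\<phi> s - c * s)) \<le> K * norm ((p t, q t) - (p s, q s)) + \<bar>c\<bar> * (t - s)"
      using lip[of s t] st by (simp add: abs_mult)
  qed
  then have "\<phi> b - c * b \<le> \<phi> a - c * a"
  proof (rule abs_continuous_nonincreasing[OF _ ab(2) negligible_S])
    fix t assume t: "t \<in> {a..b} - S"
    then obtain D where D: "D \<le> c" "(\<phi> has_real_derivative D) (at t within {0..})" using deriv by blast
    have "((\<lambda>t. \<phi> t - c * t) has_real_derivative D - c) (at t within {a..b})"
      using has_field_derivative_subset[OF D(2), of "{a..b}"] ab
      by (auto intro!: derivative_eq_intros)
    then show "\<exists>D\<le>0. ((\<lambda>t. \<phi> t - c * t) has_real_derivative D) (at t within {a..b})"
      using D(1) by (intro exI[of _ "D - c"]) auto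
  qed
  then show ?thesis by (simp add: algebra_simps)
qed

text \<open>Squared distances are Lipschitz only on bounded sets. Continuity supplies a bound on
  each compact window before any global bound is available.\<close>

lemma bounded_flow_on:
  assumes "0 \<le> a"
  obtains B where "\<And>t. t \<in> {a..b} \<Longrightarrow> norm (p t - r) \<le> B" "\<And>t. t \<in> {a..b} \<Longrightarrow> norm (q t - s) \<le> B"
proof -
  have "bounded ((\<lambda>t. (p t, q t) - (r, s)) ` {a..b})"
    by (intro compact_imp_bounded compact_continuous_image continuous_intros continuous_flow assms compact_Icc)
  then obtain B where B: "\<And>t. t \<in> {a..b} \<Longrightarrow> norm ((p t, q t) - (r, s)) \<le> B"
    unfolding bounded_iff by blast
  have "norm (p t - r) \<le> B" "norm (q t - s) \<le> B" if "t \<in> {a..b}" for t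
    using B[OF that] norm_fst_le[of "p t - r" "q t - s"] norm_snd_le[of "q t - s" "p t - r"] by auto
  then show thesis using that by blast
qed

text \<open>Pairing the normal-cone inequality with a point r of \<open>C\<close> eliminates the
  unknown projected velocity in favour of \<open>Gp\<close>.\<close>

lemma growth_dist_p:
  assumes ab: "0 \<le> a" "a \<le> b" and r: "r \<in> C"
    and c: "\<And>t. t \<in> {a..b} \<Longrightarrow> - (Gp (p t) (q t) \<bullet> (p t - r)) \<le> c"
  shows "(norm (p b - r))\<^sup>2 / 2 - (norm (p a - r))\<^sup>2 / 2 \<le> c * (b - a)"
proof -
  obtain B where B: "\<And>t. t \<in> {a..b} \<Longrightarrow> norm (p t - r) \<le> B" "\<And>t. t \<in> {a..b} \<Longrightarrow> norm (q t - 0) \<le> B"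
    using bounded_flow_on[OF ab(1), of b r 0] by blast
  show ?thesis
  proof (rule growth_bound[OF ab, where K = B])
    fix s t assume st: "s \<in> {a..b}" "t \<in> {a..b}"
    have "0 \<le> B" using B(1)[OF st(1)] norm_ge_zero order_trans by blast
    have "\<bar>(norm (p t - r))\<^sup>2 / 2 - (norm (p s - r))\<^sup>2 / 2\<bar> \<le> B * norm (p t - p s)"
      using half_norm_sq_lipschitz[OF B(1)[OF st(2)] B(1)[OF st(1)]] by simp
    also have "\<dots> \<le> B * norm ((p t, q t) - (p s, q s))"
      using \<open>0 \<le> B\<close> norm_fst_le[of "p t - p s" "q t - q s"] by (intro mult_left_mono) auto
    finally show "\<bar>(norm (p t - r))\<^sup>2 / 2 - (norm (p s - r))\<^sup>2 / 2\<bar> \<le> B * norm ((p t, q t) - (p s, q s))" .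
  next
    fix t assume t: "t \<in> {a..b} - S"
    with ab obtain u where u: "(p has_vector_derivative u) (at t within {0..})"
      "(- Gp (p t) (q t) - u) \<bullet> (r - p t) \<le> 0"
      using deriv_p[of t] r by auto
    have "u \<bullet> (p t - r) \<le> c"
      using u(2) c[of t] t by (simp add: algebra_simps)
    with has_real_derivative_half_norm_sq[OF u(1), of r]
    show "\<exists>D\<le>c. ((\<lambda>t. (norm (p t - r))\<^sup>2 / 2) has_real_derivative D) (at t within {0..})" by blast
  qed
qed

lemma growth_inner_p:
  assumes ab: "0 \<le> a" "a \<le> b"
    and c: "\<And>t. t \<in> {a..b} \<Longrightarrow> norm (Gp (p t) (q t)) \<le> c"
  shows "p b \<bullet> h - p a \<bullet> h \<le> c * norm h * (b - a)"
proof (rule growth_bound[OF ab, where K = "norm h"])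
  fix s t
  have "\<bar>p t \<bullet> h - p s \<bullet> h\<bar> \<le> norm (p t - p s) * norm h"
    by (metis Cauchy_Schwarz_ineq2 inner_diff_left)
  also have "\<dots> \<le> norm h * norm ((p t, q t) - (p s, q s))"
    using norm_fst_le[of "p t - p s" "q t - q s"] by (simp add: mult.commute mult_left_mono)
  finally show "\<bar>p t \<bullet> h - p s \<bullet> h\<bar> \<le> norm h * norm ((p t, q t) - (p s, q s))" .
next
  fix t assume t: "t \<in> {a..b} - S"
  with ab obtain u where u: "(p has_vector_derivative u) (at t within {0..})" "norm u \<le> norm (Gp (p t) (q t))"
    using deriv_p[of t] by auto
  have "u \<bullet> h \<le> norm u * norm h" by (rule norm_cauchy_schwarz)
  also have "\<dots> \<le> c * norm h"
    using u(2) c[of t] t by (intro mult_right_mono) auto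
  finally show "\<exists>D\<le>c * norm h. ((\<lambda>t. p t \<bullet> h) has_real_derivative D) (at t within {0..})"
    using has_real_derivative_inner[OF u(1)] by blast
qed

lemma growth_inner_q:
  assumes ab: "0 \<le> a" "a \<le> b"
    and c: "\<And>t. t \<in> {a..b} \<Longrightarrow> Gq (p t) (q t) \<bullet> h \<le> c"
  shows "q b \<bullet> h - q a \<bullet> h \<le> c * (b - a)"
proof (rule growth_bound[OF ab, where K = "norm h"])
  fix s t
  have "\<bar>q t \<bullet> h - q s \<bullet> h\<bar> \<le> norm (q t - q s) * norm h"
    by (metis Cauchy_Schwarz_ineq2 inner_diff_left)
  also have "\<dots> \<le> norm h * norm ((p t, q t) - (p s, q s))"
    using norm_snd_le[of "q t - q s" "p t - p s"] by (simp add: mult.commute mult_left_mono)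
  finally show "\<bar>q t \<bullet> h - q s \<bullet> h\<bar> \<le> norm h * norm ((p t, q t) - (p s, q s))" .
next
  fix t assume t: "t \<in> {a..b} - S"
  with ab deriv_q[of t] have "(q has_vector_derivative Gq (p t) (q t)) (at t within {0..})" by auto
  from has_real_derivative_inner[OF this, of h] c[of t] t
  show "\<exists>D\<le>c. ((\<lambda>t. q t \<bullet> h) has_real_derivative D) (at t within {0..})" by auto
qed

text \<open>Convexity bounds the p-part by L r q - L p q, concavity bounds the q-part by L p q - L p
  s; the common value L p q cancels.\<close>

lemma growth_energy:
  assumes ab: "0 \<le> a" "a \<le> b" and r: "r \<in> C"
    and c: "\<And>t. t \<in> {a..b} \<Longrightarrow> L r (q t) - L (p t) s \<le> c"
  shows "((norm (p b - r))\<^sup>2 / 2 + (norm (q b - s))\<^sup>2 / 2) - ((norm (p a - r))\<^sup>2 / 2 + (norm (q a - s))\<^sup>2 / 2) \<le> c * (b - a)"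
proof -
  obtain B where B: "\<And>t. t \<in> {a..b} \<Longrightarrow> norm (p t - r) \<le> B" "\<And>t. t \<in> {a..b} \<Longrightarrow> norm (q t - s) \<le> B"
    using bounded_flow_on[OF ab(1), of b r s] by blast
  show ?thesis
  proof (rule growth_bound[OF ab, where K = "B + B"])
    fix s' t assume st: "s' \<in> {a..b}" "t \<in> {a..b}"
    have "0 \<le> B" using B(1)[OF st(1)] norm_ge_zero order_trans by blast
    have 1: "\<bar>(norm (p t - r))\<^sup>2 / 2 - (norm (p s' - r))\<^sup>2 / 2\<bar> \<le> B * norm (p t - p s')"
      using half_norm_sq_lipschitz[OF B(1)[OF st(2)] B(1)[OF st(1)]] by simp
    have 2: "\<bar>(norm (q t - s))\<^sup>2 / 2 - (norm (q s' - s))\<^sup>2 / 2\<bar> \<le> B * norm (q t - q s')"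
      using half_norm_sq_lipschitz[OF B(2)[OF st(2)] B(2)[OF st(1)]] by simp
    have 3: "B * norm (p t - p s') \<le> B * norm ((p t, q t) - (p s', q s'))"
      using \<open>0 \<le> B\<close> norm_fst_le[of "p t - p s'" "q t - q s'"] by (intro mult_left_mono) auto
    have 4: "B * norm (q t - q s') \<le> B * norm ((p t, q t) - (p s', q s'))"
      using \<open>0 \<le> B\<close> norm_snd_le[of "q t - q s'" "p t - p s'"] by (intro mult_left_mono) auto
    show "\<bar>((norm (p t - r))\<^sup>2 / 2 + (norm (q t - s))\<^sup>2 / 2) - ((norm (p s' - r))\<^sup>2 / 2 + (norm (q s' - s))\<^sup>2 / 2)\<bar>
        \<le> (B + B) * norm ((p t, q t) - (p s', q s'))"
      using 1 2 3 4 by (simp only: distrib_right abs_le_iff) linarith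
  next
    fix t assume t: "t \<in> {a..b} - S"
    with ab obtain u where u: "(p has_vector_derivative u) (at t within {0..})"
      "(- Gp (p t) (q t) - u) \<bullet> (r - p t) \<le> 0"
      using deriv_p[of t] r by auto
    have dq: "(q has_vector_derivative Gq (p t) (q t)) (at t within {0..})" using deriv_q[of t] t ab by auto
    have pC: "p t \<in> C" using mem[of t] t ab by auto
    have "u \<bullet> (p t - r) + Gq (p t) (q t) \<bullet> (q t - s) \<le> c"
      using u(2) c[of t] t convex_L[OF r pC, of "q t"] concave_L[OF pC, of s "q t"]
      by (simp add: algebra_simps)
    with DERIV_add[OF has_real_derivative_half_norm_sq[OF u(1), of r] has_real_derivative_half_norm_sq[OF dq, of s]]
    show "\<exists>D\<le>c. ((\<lambda>t. (norm (p t - r))\<^sup>2 / 2 + (norm (q t - s))\<^sup>2 / 2) has_real_derivative D) (at t within {0..})"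
      by blast
  qed
qed

section \<open>Energy relative to a saddle point, boundedness of the flow, and asymptotics\<close>

definition energy :: "'p \<Rightarrow> 'q \<Rightarrow> real \<Rightarrow> real" where
  "energy r s t = (norm (p t - r))\<^sup>2 / 2 + (norm (q t - s))\<^sup>2 / 2"

lemma energy_nonneg: "energy r s t \<ge> 0"
  by (simp add: energy_def)

lemma saddle_gap:
  assumes "saddle_point L C UNIV pS qS" and "t \<ge> 0"
  shows "L pS (q t) \<le> L (p t) qS"
proof (rule order_trans[of _ "L pS qS"])
  show "L pS (q t) \<le> L pS qS" "L pS qS \<le> L (p t) qS"
    using assms mem[of t] by (auto simp: saddle_point_def)
qed

lemma energy_antimono:
  assumes sad: "saddle_point L C UNIV pS qS" and ab: "0 \<le> a" "a \<le> b"
  shows "energy pS qS b \<le> energy pS qS a"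
proof -
  have "L pS (q t) - L (p t) qS \<le> 0" if "t \<in> {a..b}" for t
    using saddle_gap[OF sad, of t] that ab by simp
  from growth_energy[OF ab _ this] show ?thesis
    using sad by (simp add: energy_def saddle_point_def)
qed

lemma bounded_flow:
  assumes sad: "saddle_point L C UNIV pS qS"
  obtains B where "\<And>t. t \<ge> 0 \<Longrightarrow> norm (p t, q t) \<le> B"
proof -
  have "norm (p t, q t) \<le> norm (pS, qS) + sqrt (2 * energy pS qS 0)" if "t \<ge> 0" for t
  proof -
    have "(norm ((p t, q t) - (pS, qS)))\<^sup>2 = 2 * energy pS qS t"
      by (simp add: energy_def norm_Pair)
    also have "\<dots> \<le> 2 * energy pS qS 0" using energy_antimono[OF sad _ that] by simp
    finally have "norm ((p t, q t) - (pS, qS)) \<le> sqrt (2 * energy pS qS 0)"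
      by (rule real_le_rsqrt)
    then show ?thesis
      using norm_triangle_ineq[of "(p t, q t) - (pS, qS)" "(pS, qS)"] by simp
  qed
  then show thesis using that by blast
qed

text \<open>The gradients are bounded on a ball containing the trajectory and bound its velocity, so
  the flow is Lipschitz in time. This supplies the uniform continuity that the Barbalat argument
  needs.\<close>

lemma uniformly_continuous_along_flow:
  fixes F :: "'p \<times> 'q \<Rightarrow> real"
  assumes sad: "saddle_point L C UNIV pS qS" and F: "continuous_on UNIV F" and e: "e > 0"
  shows "\<exists>d>0. \<forall>s\<ge>0. \<forall>t\<ge>0. \<bar>s - t\<bar> \<le> d \<longrightarrow> \<bar>F (p s, q s) - F (p t, q t)\<bar> < e"
proof -
  obtain B where B: "\<And>t. t \<ge> 0 \<Longrightarrow> norm (p t, q t) \<le> B" using bounded_flow[OF sad] by blast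
  have "bounded ((\<lambda>z. (Gp (fst z) (snd z), Gq (fst z) (snd z))) ` cball 0 B)"
    by (intro compact_imp_bounded compact_continuous_image continuous_on_Pair
        continuous_on_subset[OF cont_Gp] continuous_on_subset[OF cont_Gq]) auto
  then obtain M where M: "\<And>z. z \<in> cball 0 B \<Longrightarrow> norm (Gp (fst z) (snd z), Gq (fst z) (snd z)) \<le> M"
    unfolding bounded_iff by blast
  have MG: "norm (Gp (p t) (q t)) \<le> M" "norm (Gq (p t) (q t)) \<le> M" if "t \<ge> 0" for t
    using M[of "(p t, q t)"] B[OF that] norm_fst_le[of "Gp (p t) (q t)" "Gq (p t) (q t)"]
      norm_snd_le[of "Gq (p t) (q t)" "Gp (p t) (q t)"] by auto
  have M0: "M \<ge> 0" using MG(1)[of 0] norm_ge_zero[of "Gp (p 0) (q 0)"] by linarith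
  have speed: "norm ((p b, q b) - (p a, q a)) \<le> 2 * M * (b - a)" if ab: "0 \<le> a" "a \<le> b" for a b
  proof -
    \<comment> \<open>Testing the scalar growth bounds in the direction of the increment itself
      turns them into norm bounds.\<close>
    let ?h = "p b - p a" and ?k = "q b - q a"
    have "?h \<bullet> ?h \<le> M * norm ?h * (b - a)"
      using growth_inner_p[OF ab, of M ?h] MG(1) ab by (simp add: inner_diff_left)
    then have "norm ?h * norm ?h \<le> norm ?h * (M * (b - a))"
      by (simp add: power2_norm_eq_inner[symmetric] power2_eq_square mult_ac)
    then have h: "norm ?h \<le> M * (b - a)"
      using M0 ab by (cases "norm ?h = 0") auto
    have "Gq (p t) (q t) \<bullet> ?k \<le> M * norm ?k" if "t \<in> {a..b}" for t
      using norm_cauchy_schwarz[of "Gq (p t) (q t)" ?k] MG(2)[of t] that ab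
        mult_right_mono[of "norm (Gq (p t) (q t))" M "norm ?k"] by auto
    from growth_inner_q[OF ab this] have "?k \<bullet> ?k \<le> M * norm ?k * (b - a)"
      by (simp add: inner_diff_left)
    then have "norm ?k * norm ?k \<le> norm ?k * (M * (b - a))"
      by (simp add: power2_norm_eq_inner[symmetric] power2_eq_square mult_ac)
    then have k: "norm ?k \<le> M * (b - a)"
      using M0 ab by (cases "norm ?k = 0") auto
    show ?thesis using h k norm_Pair_le[of ?h ?k] by simp
  qed
  have "uniformly_continuous_on (cball 0 B) F"
    by (intro compact_uniformly_continuous continuous_on_subset[OF F]) auto
  then obtain \<delta> where \<delta>: "\<delta> > 0"
    "\<And>z z'. z \<in> cball 0 B \<Longrightarrow> z' \<in> cball 0 B \<Longrightarrow> dist z' z < \<delta> \<Longrightarrow> dist (F z') (F z) < e"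
    using e unfolding uniformly_continuous_on_def by blast
  define d where "d = \<delta> / (2 * M + 1) / 2"
  have d: "d > 0" "2 * M * d < \<delta>"
    using \<delta>(1) M0 by (auto simp: d_def field_simps add_pos_nonneg)
  have "\<bar>F (p s, q s) - F (p t, q t)\<bar> < e" if st: "s \<ge> 0" "t \<ge> 0" "\<bar>s - t\<bar> \<le> d" for s t
  proof -
    have "norm ((p s, q s) - (p t, q t)) \<le> 2 * M * \<bar>s - t\<bar>"
      using speed[of s t] speed[of t s] st norm_minus_commute[of "(p s, q s)" "(p t, q t)"]
      by (cases "s \<le> t") auto
    also have "\<dots> \<le> 2 * M * d" using st M0 by (intro mult_left_mono) auto
    finally have "dist (p s, q s) (p t, q t) < \<delta>" using d(2) by (simp add: dist_norm)
    then have "dist (F (p s, q s)) (F (p t, q t)) < e"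
      using B[OF st(1)] B[OF st(2)] by (intro \<delta>(2)) auto
    then show ?thesis by (simp add: dist_real_def)
  qed
  with d(1) show ?thesis by blast
qed

lemma energy_convergent:
  assumes sad: "saddle_point L C UNIV pS qS"
  obtains l where "(energy pS qS \<longlongrightarrow> l) at_top"
proof -
  define l where "l = Inf (energy pS qS ` {0..})"
  have bdd: "bdd_below (energy pS qS ` {0..})"
    using energy_nonneg by (intro bdd_belowI[of _ 0]) auto
  have "(energy pS qS \<longlongrightarrow> l) at_top"
  proof (rule order_tendstoI)
    fix c assume "c < l"
    have "c < energy pS qS t" if "t \<ge> 0" for t
      using \<open>c < l\<close> cInf_lower[OF _ bdd, of "energy pS qS t"] that unfolding l_def by auto
    then show "\<forall>\<^sub>F t in at_top. c < energy pS qS t"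
      unfolding eventually_at_top_linorder by blast
  next
    fix c assume "l < c"
    then obtain T where T: "T \<ge> 0" "energy pS qS T < c"
      unfolding l_def by (subst (asm) cInf_less_iff) (use bdd in auto)
    then have "energy pS qS t < c" if "t \<ge> T" for t
      using energy_antimono[OF sad T(1) that] by simp
    then show "\<forall>\<^sub>F t in at_top. energy pS qS t < c"
      unfolding eventually_at_top_linorder by blast
  qed
  then show thesis using that by blast
qed

text \<open>The negative gap bounds the growth rate of the convergent energy, so the Barbalat
  argument bounds the gap from above; the saddle inequalities bound it from below by 0.\<close>

lemma gap_tendsto_0:
  assumes sad: "saddle_point L C UNIV pS qS"
  shows "((\<lambda>t. L (p t) qS - L pS (q t)) \<longlongrightarrow> 0) at_top"
proof -
  obtain l where l: "(energy pS qS \<longlongrightarrow> l) at_top" using energy_convergent[OF sad] by blast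
  define F where "F = (\<lambda>z. L pS (snd z) - L (fst z) qS)"
  have c1: "continuous_on UNIV (\<lambda>z :: 'p \<times> 'q. L pS (snd z))"
    using continuous_on_compose2[OF cont_L, of UNIV "\<lambda>z :: 'p \<times> 'q. (pS, snd z)"]
    by (simp add: continuous_on_Pair continuous_on_snd continuous_on_id)
  have c2: "continuous_on UNIV (\<lambda>z :: 'p \<times> 'q. L (fst z) qS)"
    using continuous_on_compose2[OF cont_L, of UNIV "\<lambda>z :: 'p \<times> 'q. (fst z, qS)"]
    by (simp add: continuous_on_Pair continuous_on_fst continuous_on_id)
  have F: "continuous_on UNIV F" unfolding F_def by (intro continuous_on_diff c1 c2)
  have low: "\<forall>\<^sub>F t in at_top. F (p t, q t) > - e" if e: "e > 0" for e
  proof (rule barbalat_lower[OF l e uniformly_continuous_along_flow[OF sad F]])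
    fix a b c assume ab: "(0::real) \<le> a" "a \<le> b" and c: "\<forall>t\<in>{a..b}. F (p t, q t) \<le> c"
    have "pS \<in> C" using sad by (simp add: saddle_point_def)
    from growth_energy[OF ab this, of qS c] c show "energy pS qS b - energy pS qS a \<le> c * (b - a)"
      by (simp add: energy_def F_def)
  qed
  have "\<forall>\<^sub>F t in at_top. dist (L (p t) qS - L pS (q t)) 0 < e" if e: "e > 0" for e
    using low[OF e] eventually_ge_at_top[of 0]
  proof eventually_elim
    case (elim t)
    have "L pS (q t) \<le> L (p t) qS" using saddle_gap[OF sad elim(2)] .
    then show ?case using elim(1) by (simp add: F_def dist_real_def)
  qed
  then show ?thesis by (rule tendstoI)
qed

text \<open>The component q is not projected, so \<open>Gq\<close> is its exact velocity and the
  one-sided argument applies in both directions h and -h.\<close>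

lemma Gq_inner_tendsto_0:
  assumes sad: "saddle_point L C UNIV pS qS" and lim: "((\<lambda>t. q t \<bullet> h) \<longlongrightarrow> l) at_top"
  shows "((\<lambda>t. Gq (p t) (q t) \<bullet> h) \<longlongrightarrow> 0) at_top"
proof -
  have low: "\<forall>\<^sub>F t in at_top. Gq (p t) (q t) \<bullet> h' > - e"
    if e: "e > 0" and lim': "((\<lambda>t. q t \<bullet> h') \<longlongrightarrow> l') at_top" for e h' l'
  proof (rule barbalat_lower[OF lim' e])
    have "continuous_on UNIV (\<lambda>z. Gq (fst z) (snd z) \<bullet> h')"
      by (intro continuous_intros cont_Gq)
    from uniformly_continuous_along_flow[OF sad this]
    show "\<exists>d>0. \<forall>s\<ge>0. \<forall>t\<ge>0. \<bar>s - t\<bar> \<le> d \<longrightarrow> \<bar>Gq (p s) (q s) \<bullet> h' - Gq (p t) (q t) \<bullet> h'\<bar> < e" if "e > 0" for e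
      using that by simp
  qed (use growth_inner_q in auto)
  have "((\<lambda>t. q t \<bullet> (- h)) \<longlongrightarrow> - l) at_top"
    using tendsto_minus[OF lim] by simp
  note low' = low[OF _ this]
  have "\<forall>\<^sub>F t in at_top. dist (Gq (p t) (q t) \<bullet> h) 0 < e" if e: "e > 0" for e
    using low[OF e lim] low'[OF e] by eventually_elim (simp add: dist_real_def abs_less_iff)
  then show ?thesis by (rule tendstoI)
qed

text \<open>The product of \<open>Gp\<close> with p - r need not vary slowly by itself;
  \<open>gap\<close> trades it for \<open>(q t - q0) \<bullet> h\<close>, whose rate of change tends
  to 0 by \<open>slow\<close>. This extends a sign at one sampled time to a whole window.\<close>

lemma limit_point_variational:
  assumes sad: "saddle_point L C UNIV pS qS" and r: "r \<in> C"
    and gap: "((\<lambda>t. Gp (p t) (q t) \<bullet> (p t - r) + (q t - q0) \<bullet> h) \<longlongrightarrow> 0) at_top"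
    and slow: "((\<lambda>t. Gq (p t) (q t) \<bullet> h) \<longlongrightarrow> 0) at_top"
    and \<tau>: "filterlim \<tau> at_top sequentially" and lim: "(\<lambda>n. q (\<tau> n)) \<longlonglongrightarrow> qL"
  shows "(qL - q0) \<bullet> h \<ge> 0"
proof (rule ccontr)
  \<comment> \<open>A quarter of the violation: the limit value is -4e, a sampled time is already
    below -3e, drift over the window costs e, and the error in \<open>gap\<close> costs another e. A
    decrease at rate e remains.\<close>
  define e where "e = - ((qL - q0) \<bullet> h) / 4"
  assume "\<not> (qL - q0) \<bullet> h \<ge> 0"
  then have e: "e > 0" by (simp add: e_def)
  obtain B where B: "\<And>t. t \<ge> 0 \<Longrightarrow> norm (p t, q t) \<le> B" using bounded_flow[OF sad] by blast
  define D where "D = (B + norm r)\<^sup>2 / 2"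
  have D: "(norm (p t - r))\<^sup>2 / 2 \<le> D" if "t \<ge> 0" for t
  proof -
    have "norm (p t - r) \<le> B + norm r"
      using norm_triangle_ineq4[of "p t" r] B[OF that] norm_fst_le[of "p t" "q t"] by simp
    then show ?thesis by (simp add: D_def power_mono)
  qed
  have D0: "D \<ge> 0" by (simp add: D_def)
  \<comment> \<open>A window so long that decreasing at rate \<open>e\<close> exhausts the bound \<open>D\<close>.\<close>
  define W where "W = (D + 1) / e"
  have W: "W > 0" "e * W = D + 1" using e D0 by (auto simp: W_def)
  have "\<forall>\<^sub>F t in at_top. Gq (p t) (q t) \<bullet> h < e / W"
    using slow e W(1) by (intro order_tendstoD(2)) auto
  moreover have "\<forall>\<^sub>F t in at_top. Gp (p t) (q t) \<bullet> (p t - r) + (q t - q0) \<bullet> h > - e"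
    using gap e by (intro order_tendstoD(1)) auto
  ultimately have "\<forall>\<^sub>F t in at_top. Gq (p t) (q t) \<bullet> h < e / W \<and> Gp (p t) (q t) \<bullet> (p t - r) + (q t - q0) \<bullet> h > - e"
    by eventually_elim auto
  then obtain T where T: "\<And>t. t \<ge> T \<Longrightarrow> Gq (p t) (q t) \<bullet> h < e / W"
     "\<And>t. t \<ge> T \<Longrightarrow> Gp (p t) (q t) \<bullet> (p t - r) + (q t - q0) \<bullet> h > - e"
    unfolding eventually_at_top_linorder by blast
  have "(\<lambda>n. (q (\<tau> n) - q0) \<bullet> h) \<longlonglongrightarrow> (qL - q0) \<bullet> h" by (intro tendsto_intros lim)
  then have "\<forall>\<^sub>F n in sequentially. (q (\<tau> n) - q0) \<bullet> h < - 3 * e"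
    using e by (intro order_tendstoD(2)) (auto simp: e_def)
  moreover have "\<forall>\<^sub>F n in sequentially. \<tau> n \<ge> max T 0"
    using \<tau> unfolding filterlim_at_top by blast
  ultimately have "\<forall>\<^sub>F n in sequentially. (q (\<tau> n) - q0) \<bullet> h < - 3 * e \<and> \<tau> n \<ge> max T 0"
    by eventually_elim auto
  then obtain n where n: "(q (\<tau> n) - q0) \<bullet> h < - 3 * e" "\<tau> n \<ge> max T 0"
    unfolding eventually_sequentially by blast
  define a where "a = \<tau> n"
  have a: "a \<ge> 0" "a \<ge> T" "(q a - q0) \<bullet> h < - 3 * e" using n by (auto simp: a_def)
  have "- (Gp (p t) (q t) \<bullet> (p t - r)) \<le> - e" if t: "t \<in> {a..a + W}" for t
  proof -
    have "Gq (p s) (q s) \<bullet> h \<le> e / W" if "s \<in> {a..t}" for s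
      using T(1)[of s] that a(2) by auto
    then have "q t \<bullet> h - q a \<bullet> h \<le> e / W * (t - a)"
      using growth_inner_q[OF a(1), of t h "e/W"] t by auto
    also have "\<dots> \<le> e / W * W"
      using t e W(1) by (intro mult_left_mono) auto
    finally have "q t \<bullet> h - q a \<bullet> h \<le> e" using W(1) by simp
    moreover have "Gp (p t) (q t) \<bullet> (p t - r) + (q t - q0) \<bullet> h > - e" using T(2)[of t] a(2) t by auto
    ultimately show ?thesis using a(3) by (simp add: inner_diff_left)
  qed
  from growth_dist_p[OF a(1) _ r this, of "a + W"] W
  have "(norm (p (a + W) - r))\<^sup>2 / 2 - (norm (p a - r))\<^sup>2 / 2 \<le> - (D + 1)" by simp
  moreover have "(norm (p (a + W) - r))\<^sup>2 / 2 \<ge> 0" by simp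
  ultimately show False using D[OF a(1)] by linarith
qed

lemma converges_to_saddle_limit_point:
  assumes sad: "saddle_point L C UNIV pL qL"
    and \<tau>: "filterlim \<tau> at_top sequentially" and lim: "(\<lambda>n. (p (\<tau> n), q (\<tau> n))) \<longlonglongrightarrow> (pL, qL)"
  shows "((\<lambda>t. (p t, q t)) \<longlongrightarrow> (pL, qL)) at_top"
proof -
  obtain l where l: "(energy pL qL \<longlongrightarrow> l) at_top" using energy_convergent[OF sad] by blast
  have lim': "(\<lambda>n. p (\<tau> n)) \<longlonglongrightarrow> pL" "(\<lambda>n. q (\<tau> n)) \<longlonglongrightarrow> qL"
    using tendsto_fst[OF lim] tendsto_snd[OF lim] by simp_all
  have "(\<lambda>n. energy pL qL (\<tau> n)) \<longlonglongrightarrow> (norm (pL - pL))\<^sup>2 / 2 + (norm (qL - qL))\<^sup>2 / 2"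
    unfolding energy_def by (intro tendsto_intros lim') auto
  moreover have "(\<lambda>n. energy pL qL (\<tau> n)) \<longlonglongrightarrow> l" by (rule filterlim_compose[OF l \<tau>])
  ultimately have "l = 0" using LIMSEQ_unique by fastforce
  have eq: "norm ((p t, q t) - (pL, qL)) = sqrt (2 * energy pL qL t)" for t
    by (simp add: energy_def norm_Pair)
  have "((\<lambda>t. sqrt (2 * energy pL qL t)) \<longlongrightarrow> sqrt (2 * 0)) at_top"
    using l \<open>l = 0\<close> by (intro tendsto_intros) auto
  then have "((\<lambda>t. norm ((p t, q t) - (pL, qL))) \<longlongrightarrow> 0) at_top"
    by (simp only: eq) simp
  then show ?thesis by (simp only: tendsto_norm_zero_iff LIM_zero_iff)
qed

end

subsection \<open>The graph Laplacian\<close>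

lemma inner_matrix_vector_symmetric:
  fixes M :: "real^'a^'a::finite"
  assumes "transpose M = M"
  shows "(M *v x) \<bullet> y = x \<bullet> (M *v y)"
  by (metis assms dot_lmul_matrix transpose_matrix_vector)

text \<open>A gradient-descent step replaces spectral theory: the form is nonnegative at x - Mx/K,
  with K bounding the operator norm, and expanding there gives the estimate. It converts a vanishing
  quadratic form into a vanishing image.\<close>

lemma norm_psd_matrix_vector_le:
  fixes M :: "real^'a^'a::finite"
  assumes sym: "transpose M = M" and psd: "\<And>x. x \<bullet> (M *v x) \<ge> 0"
  shows "\<exists>K>0. \<forall>x. (norm (M *v x))\<^sup>2 \<le> K * (x \<bullet> (M *v x))"
proof -
  obtain K where K: "K > 0" "\<And>x. norm (M *v x) \<le> norm x * K"
    using bounded_linear.pos_bounded[OF matrix_vector_mul_bounded_linear[of M]] by auto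
  have "(norm (M *v x))\<^sup>2 \<le> K * (x \<bullet> (M *v x))" for x
  proof -
    let ?y = "M *v x"
    have "?y \<bullet> (M *v ?y) \<le> norm ?y * (norm ?y * K)"
      using norm_cauchy_schwarz[of ?y "M *v ?y"] K(2)[of ?y] mult_left_mono[OF K(2)[of ?y], of "norm ?y"] by simp
    then have 1: "?y \<bullet> (M *v ?y) \<le> K * (norm ?y)\<^sup>2" by (simp add: power2_eq_square mult_ac)
    have "0 \<le> (x - (1/K) *\<^sub>R ?y) \<bullet> (M *v (x - (1/K) *\<^sub>R ?y))" by (rule psd)
    also have "\<dots> = x \<bullet> ?y - (1/K) * (x \<bullet> (M *v ?y)) - (1/K) * (?y \<bullet> ?y) + (1/K)\<^sup>2 * (?y \<bullet> (M *v ?y))"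
      by (simp add: matrix_vector_mult_diff_distrib matrix_vector_mult_scaleR inner_diff_left inner_diff_right
          power2_eq_square algebra_simps)
    also have "\<dots> = x \<bullet> ?y - (2/K) * (norm ?y)\<^sup>2 + (1/K)\<^sup>2 * (?y \<bullet> (M *v ?y))"
      unfolding inner_matrix_vector_symmetric[OF sym, of x ?y, symmetric] power2_norm_eq_inner by simp
    also have "\<dots> \<le> x \<bullet> ?y - (2/K) * (norm ?y)\<^sup>2 + (1/K)\<^sup>2 * (K * (norm ?y)\<^sup>2)"
      using 1 by (intro add_left_mono mult_left_mono) auto
    also have "\<dots> = x \<bullet> ?y - (1/K) * (norm ?y)\<^sup>2"
      using K(1) by (simp add: power2_eq_square field_simps)
    finally show ?thesis using K(1) by (simp add: field_simps)
  qed
  with K(1) show ?thesis by blast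
qed

lemma tendsto_psd_matrix_vector:
  fixes M :: "real^'a^'a::finite"
  assumes sym: "transpose M = M" and psd: "\<And>x. x \<bullet> (M *v x) \<ge> 0"
    and lim: "((\<lambda>t. y t \<bullet> (M *v y t)) \<longlongrightarrow> 0) F"
  shows "((\<lambda>t. M *v y t) \<longlongrightarrow> 0) F"
proof -
  obtain K where K: "\<And>x. (norm (M *v x))\<^sup>2 \<le> K * (x \<bullet> (M *v x))"
    using norm_psd_matrix_vector_le[OF sym psd] by auto
  have "((\<lambda>t. sqrt (K * (y t \<bullet> (M *v y t)))) \<longlongrightarrow> sqrt (K * 0)) F"
    by (intro tendsto_intros lim)
  then have lim0: "((\<lambda>t. sqrt (K * (y t \<bullet> (M *v y t)))) \<longlongrightarrow> 0) F" by simp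
  have "norm (M *v y t) \<le> sqrt (K * (y t \<bullet> (M *v y t)))" for t
    by (rule real_le_rsqrt) (rule K)
  then show ?thesis
    by (intro Lim_null_comparison[OF always_eventually lim0]) auto
qed

lemma transpose_laplacian:
  assumes "transpose A = A"
  shows "transpose (laplacian A) = laplacian A"
proof -
  have "A $ i $ j = A $ j $ i" for i j
    by (metis assms transpose_def vec_lambda_beta)
  then show ?thesis
    by (auto simp: laplacian_def degree_matrix_def transpose_def vec_eq_iff)
qed

lemma laplacian_mult_nth:
  "(laplacian A *v x) $ i = (\<Sum>j\<in>UNIV. A $ i $ j * (x $ i - x $ j))"
proof -
  have "(laplacian A *v x) $ i = (\<Sum>j\<in>UNIV. (if i = j then (\<Sum>k\<in>UNIV. A $ i $ k) * x $ j else 0) - A $ i $ j * x $ j)"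
    unfolding matrix_vector_mult_def laplacian_def degree_matrix_def
    by (auto simp: left_diff_distrib intro!: sum.cong)
  also have "\<dots> = (\<Sum>k\<in>UNIV. A $ i $ k) * x $ i - (\<Sum>j\<in>UNIV. A $ i $ j * x $ j)"
    by (simp add: sum_subtractf)
  finally show ?thesis by (simp add: sum_distrib_right sum_subtractf right_diff_distrib)
qed

lemma laplacian_psd:
  assumes sym: "transpose A = A" and nonneg: "\<And>i j. A $ i $ j \<ge> 0"
  shows "x \<bullet> (laplacian A *v x) \<ge> 0"
proof -
  have A: "A $ i $ j = A $ j $ i" for i j
    by (metis sym transpose_def vec_lambda_beta)
  let ?s = "x \<bullet> (laplacian A *v x)"
  have s: "?s = (\<Sum>i\<in>UNIV. \<Sum>j\<in>UNIV. x $ i * (A $ i $ j * (x $ i - x $ j)))"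
    by (simp add: inner_vec_def laplacian_mult_nth sum_distrib_left)
  also have "\<dots> = (\<Sum>j\<in>UNIV. \<Sum>i\<in>UNIV. x $ i * (A $ i $ j * (x $ i - x $ j)))"
    by (rule sum.swap)
  also have "\<dots> = (\<Sum>i\<in>UNIV. \<Sum>j\<in>UNIV. x $ j * (A $ i $ j * (x $ j - x $ i)))"
    using A by (auto intro!: sum.cong)
  \<comment> \<open>Adding the copy with i and j exchanged turns the form into a weighted sum of
    squared differences.\<close>
  finally have "?s + ?s = (\<Sum>i\<in>UNIV. \<Sum>j\<in>UNIV. x $ i * (A $ i $ j * (x $ i - x $ j)) + x $ j * (A $ i $ j * (x $ j - x $ i)))"
    by (simp add: s sum.distrib)
  also have "\<dots> = (\<Sum>i\<in>UNIV. \<Sum>j\<in>UNIV. A $ i $ j * (x $ i - x $ j)\<^sup>2)"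
    by (intro sum.cong refl) (simp add: power2_eq_square algebra_simps)
  also have "\<dots> \<ge> 0" by (intro sum_nonneg mult_nonneg_nonneg nonneg) auto
  finally show ?thesis by simp
qed

lemma transpose_kron: "transpose (M \<otimes>\<^sub>K K) = transpose M \<otimes>\<^sub>K transpose K"
  by (simp add: transpose_def kron_def vec_eq_iff)

text \<open>The product acts as M on each coordinate slice across the agents, so properties of M
  carry over slice by slice.\<close>

lemma kron_mat_1_mult_nth:
  "((M \<otimes>\<^sub>K (mat 1 :: real^'d^'d)) *v x) $ (i, j) = (M *v (\<chi> i. x $ (i, j :: 'd::finite))) $ i"
proof -
  have "((M \<otimes>\<^sub>K (mat 1 :: real^'d^'d)) *v x) $ (i, j)
      = (\<Sum>i'\<in>UNIV. \<Sum>j'\<in>UNIV. M $ i $ i' * (mat 1 :: real^'d^'d) $ j $ j' * x $ (i', j'))"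
    unfolding matrix_vector_mult_def kron_def
    by (simp add: sum.cartesian_product case_prod_unfold flip: UNIV_Times_UNIV)
  also have "\<dots> = (\<Sum>i'\<in>UNIV. \<Sum>j'\<in>UNIV. if j = j' then M $ i $ i' * x $ (i', j') else 0)"
    by (intro sum.cong refl) (simp add: mat_def)
  also have "\<dots> = (M *v (\<chi> i. x $ (i, j))) $ i"
    by (simp add: matrix_vector_mult_def)
  finally show ?thesis .
qed

lemma kron_mat_1_psd:
  assumes psd: "\<And>x. x \<bullet> (M *v x) \<ge> 0"
  shows "x \<bullet> ((M \<otimes>\<^sub>K (mat 1 :: real^'d^'d)) *v x) \<ge> 0"
proof -
  have "x \<bullet> ((M \<otimes>\<^sub>K (mat 1 :: real^'d^'d)) *v x)
      = (\<Sum>(i, j)\<in>UNIV. x $ (i, j) * (M *v (\<chi> i. x $ (i, j))) $ i)"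
    unfolding inner_vec_def by (intro sum.cong refl) (auto simp: kron_mat_1_mult_nth)
  also have "\<dots> = (\<Sum>i\<in>UNIV. \<Sum>j\<in>UNIV. x $ (i, j) * (M *v (\<chi> i. x $ (i, j))) $ i)"
    by (simp add: sum.cartesian_product flip: UNIV_Times_UNIV)
  also have "\<dots> = (\<Sum>j\<in>UNIV. \<Sum>i\<in>UNIV. x $ (i, j) * (M *v (\<chi> i. x $ (i, j))) $ i)"
    by (rule sum.swap)
  also have "\<dots> = (\<Sum>j\<in>UNIV. (\<chi> i. x $ (i, j)) \<bullet> (M *v (\<chi> i. x $ (i, j))))"
    by (simp add: inner_vec_def)
  also have "\<dots> \<ge> 0" by (intro sum_nonneg psd)
  finally show ?thesis .
qed

subsection \<open>Quadratic expansions\<close>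

text \<open>\<open>gradient\<close> is a definite description, so existence and uniqueness are both
  due. A continuous remainder that is homogeneous of degree two is bounded on the unit sphere, hence
  by K |h|^2 everywhere.\<close>

lemma gradient_eqI:
  fixes \<phi> :: "'a::euclidean_space \<Rightarrow> real"
  assumes expand: "\<And>h. \<phi> (y + h) = \<phi> y + D \<bullet> h + R h"
    and cont: "continuous_on UNIV R" and homog: "\<And>c h. R (c *\<^sub>R h) = c\<^sup>2 * R h"
  shows "gradient \<phi> y = D"
proof -
  have "bounded (R ` sphere 0 1)"
    by (intro compact_imp_bounded compact_continuous_image continuous_on_subset[OF cont]) auto
  then obtain K0 where K0: "\<And>h. norm h = 1 \<Longrightarrow> norm (R h) \<le> K0"
    unfolding bounded_iff by (metis imageI mem_sphere_0)
  define K where "K = max K0 0 + 1"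
  have K: "K > 0" "K0 \<le> K" by (auto simp: K_def)
  have R: "\<bar>R h\<bar> \<le> K * norm h * norm h" for h
  proof (cases "h = 0")
    case True
    then show ?thesis using homog[of 0 0] by simp
  next
    case False
    have "R h = (norm h)\<^sup>2 * R (sgn h)" using homog[of "norm h" "sgn h"] False by (simp add: sgn_div_norm)
    moreover have "\<bar>R (sgn h)\<bar> \<le> K" using K0[of "sgn h"] K(2) False by (simp add: norm_sgn)
    ultimately show ?thesis
      using mult_right_mono[of "\<bar>R (sgn h)\<bar>" K "(norm h)\<^sup>2"] by (simp add: abs_mult power2_eq_square mult_ac)
  qed
  have "GDERIV \<phi> y :> D"
    unfolding gderiv_def has_derivative_at_alt
  proof (intro conjI allI impI)
    show "bounded_linear (\<lambda>h. h \<bullet> D)" by (rule bounded_linear_inner_left)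
    fix e :: real assume e: "e > 0"
    show "\<exists>d>0. \<forall>z. norm (z - y) < d \<longrightarrow> norm (\<phi> z - \<phi> y - (z - y) \<bullet> D) \<le> e * norm (z - y)"
    proof (intro exI[of _ "e / K"] conjI allI impI)
      fix z assume z: "norm (z - y) < e / K"
      have "\<phi> z - \<phi> y - (z - y) \<bullet> D = R (z - y)"
        using expand[of "z - y"] by (simp add: inner_commute)
      moreover have "K * norm (z - y) * norm (z - y) \<le> e * norm (z - y)"
        using z K(1) by (intro mult_right_mono) (auto simp: field_simps)
      ultimately show "norm (\<phi> z - \<phi> y - (z - y) \<bullet> D) \<le> e * norm (z - y)"
        using R[of "z - y"] by simp
    qed (use e K in auto)
  qed
  then show ?thesis
    unfolding gradient_def
  proof (intro the_equality)
    fix D' assume "GDERIV \<phi> y :> D'"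
    with \<open>GDERIV \<phi> y :> D\<close> have "(\<lambda>h. h \<bullet> D') = (\<lambda>h. h \<bullet> D)"
      unfolding gderiv_def by (rule has_derivative_unique[rotated])
    then have "(D' - D) \<bullet> D' = (D' - D) \<bullet> D" by metis
    then have "(D' - D) \<bullet> (D' - D) = 0" by (simp only: inner_diff_right)
    then show "D' = D" by simp
  qed
qed

lemma quadratic_local_min_imp_critical:
  fixes D :: "'a::real_inner"
  assumes e: "e > 0" and min: "\<And>h. norm h < e \<Longrightarrow> 0 \<le> D \<bullet> h + R h"
    and homog: "\<And>c h. R (c *\<^sub>R h) = c\<^sup>2 * R h"
  shows "D = 0"
proof (rule ccontr)
  assume D: "D \<noteq> 0"
  \<comment> \<open>The step -c D stays inside the ball by the first bound; by the second its
    quadratic term is at most half of the linear decrease. The summand 1 excludes a zero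
    denominator.\<close>
  define c where "c = min (e / (2 * norm D)) ((norm D)\<^sup>2 / (2 * (\<bar>R D\<bar> + 1)))"
  have c: "c > 0" "c \<le> e / (2 * norm D)" "c \<le> (norm D)\<^sup>2 / (2 * (\<bar>R D\<bar> + 1))"
    using e D by (auto simp: c_def)
  have "norm ((- c) *\<^sub>R D) < e"
    using c(1,2) e D by (auto simp: field_simps)
  from min[OF this] have "0 \<le> D \<bullet> ((- c) *\<^sub>R D) + (- c)\<^sup>2 * R D" unfolding homog .
  then have "0 \<le> c * (c * R D - (norm D)\<^sup>2)"
    by (simp only: power2_norm_eq_inner) (simp add: power2_eq_square algebra_simps)
  then have "(norm D)\<^sup>2 \<le> c * R D" using c(1) by (simp add: zero_le_mult_iff)
  also have "\<dots> \<le> c * (\<bar>R D\<bar> + 1)" using c(1) by (intro mult_left_mono) auto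
  also have "\<dots> \<le> (norm D)\<^sup>2 / 2"
    using c(3) by (simp add: field_simps)
  finally show False using D by simp
qed


subsection \<open>The regression Lagrangian\<close>

text \<open>
  The objective is \<open>a * (residual x \<xi>)\<^sup>2\<close>; the residual is affine in \<open>\<xi>\<close> with gradient
  \<open>(-x\<^bsub>1:m-1\<^esub>; 1)\<close>, which has the same norm as \<open>(x\<^bsub>1:m-1\<^esub>; 1)\<close>.
\<close>

definition residual :: "(real, 'm::{finite,linorder}) vec \<Rightarrow> (real, 'm) vec \<Rightarrow> real" where
  "residual x \<xi> = \<xi> $ last_index - last_to_one \<xi> \<bullet> x"

definition residual_slope :: "(real, 'm::{finite,linorder}) vec \<Rightarrow> (real, 'm) vec" where
  "residual_slope x = (\<chi> j. if j = last_index then 1 else - x $ j)"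

text \<open>The adjoint of taking the i-th block; it carries a gradient with respect to one agent's
  variable back to the stacked vector.\<close>

definition lift_block :: "'n::finite \<Rightarrow> real^('d::finite) \<Rightarrow> real^('n \<times> 'd)" where
  "lift_block i y = (\<chi> p. if fst p = i then y $ snd p else 0)"

lemma block_simps [simp]:
  "block (x + y) i = block x i + block y i" "block (x - y) i = block x i - block y i"
  "block (c *\<^sub>R x) i = c *\<^sub>R block x i" "block 0 i = 0"
  by (simp_all add: block_def vec_eq_iff)

lemma inner_lift_block: "lift_block i y \<bullet> x = y \<bullet> block x i"
proof -
  have "lift_block i y \<bullet> x = (\<Sum>(i', j)\<in>UNIV. if i' = i then y $ j * x $ (i', j) else 0)"
    unfolding inner_vec_def lift_block_def by (intro sum.cong refl) auto
  also have "\<dots> = (\<Sum>i'\<in>UNIV. \<Sum>j\<in>UNIV. if i' = i then y $ j * x $ (i', j) else 0)"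
    by (simp only: sum.cartesian_product UNIV_Times_UNIV)
  also have "\<dots> = (\<Sum>j\<in>UNIV. \<Sum>i'\<in>UNIV. if i' = i then y $ j * x $ (i', j) else 0)"
    by (rule sum.swap)
  finally show ?thesis by (simp add: inner_vec_def block_def)
qed

lemma residual_add_left: "residual (x + h) \<xi> = residual x \<xi> - last_to_one \<xi> \<bullet> h"
  by (simp add: residual_def inner_add_right)

lemma residual_add_right: "residual x (\<xi> + h) = residual x \<xi> + residual_slope x \<bullet> h"
proof -
  \<comment> \<open>The increment of \<open>last_to_one\<close> vanishes at the last index and
    cancels the slope at all others.\<close>
  have "(last_to_one (\<xi> + h) - last_to_one \<xi>) \<bullet> x + residual_slope x \<bullet> h
      = (\<Sum>j\<in>UNIV. if j = last_index then h $ j else 0)"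
    unfolding inner_vec_def residual_slope_def last_to_one_def sum.distrib[symmetric]
    by (intro sum.cong) (auto simp: algebra_simps)
  then show ?thesis by (simp add: residual_def inner_diff_left)
qed

lemma norm_residual_slope: "norm (residual_slope x) = norm (last_to_one x)"
  unfolding norm_eq_sqrt_inner inner_vec_def residual_slope_def last_to_one_def
  by (intro arg_cong[where f = sqrt] sum.cong) auto

lemma continuous_on_last_to_one [continuous_intros]:
  "continuous_on S g \<Longrightarrow> continuous_on S (\<lambda>x. last_to_one (g x))"
  unfolding last_to_one_def
proof (intro continuous_on_vec_lambda)
  fix j assume g: "continuous_on S g"
  show "continuous_on S (\<lambda>x. if j = last_index then 1 else g x $ j)"
    by (cases "j = last_index") (auto intro!: continuous_intros g)
qed

lemma continuous_on_residual_slope [continuous_intros]: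
  "continuous_on S g \<Longrightarrow> continuous_on S (\<lambda>x. residual_slope (g x))"
  unfolding residual_slope_def
proof (intro continuous_on_vec_lambda)
  fix j assume g: "continuous_on S g"
  show "continuous_on S (\<lambda>x. if j = last_index then 1 else - g x $ j)"
    by (cases "j = last_index") (auto intro!: continuous_intros g)
qed

lemma continuous_on_residual [continuous_intros]:
  "continuous_on S g \<Longrightarrow> continuous_on S h \<Longrightarrow> continuous_on S (\<lambda>x. residual (g x) (h x))"
  unfolding residual_def by (intro continuous_intros)

lemma continuous_on_block [continuous_intros]:
  "continuous_on S g \<Longrightarrow> continuous_on S (\<lambda>x. block (g x) i)"
  unfolding block_def by (intro continuous_intros)

lemma continuous_on_lift_block [continuous_intros]:
  "continuous_on S g \<Longrightarrow> continuous_on S (\<lambda>x. lift_block i (g x))"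
  unfolding lift_block_def
proof (intro continuous_on_vec_lambda)
  fix j assume g: "continuous_on S g"
  show "continuous_on S (\<lambda>x. if fst j = i then g x $ snd j else 0)"
    by (cases "fst j = i") (auto intro!: continuous_intros g)
qed

lemma continuous_on_axis [continuous_intros]:
  "continuous_on S g \<Longrightarrow> continuous_on S (\<lambda>x. axis i (g x :: real))"
  unfolding axis_def
proof (intro continuous_on_vec_lambda)
  fix j assume g: "continuous_on S g"
  show "continuous_on S (\<lambda>x. if j = i then g x else 0)"
    by (cases "j = i") (auto intro!: continuous_intros g)
qed

lemma continuous_on_matrix_vector_mult [continuous_intros]:
  fixes M :: "real^'a::finite^'b::finite"
  shows "continuous_on S g \<Longrightarrow> continuous_on S (\<lambda>x. M *v g x)"
  by (rule bounded_linear.continuous_on[OF matrix_vector_mul_bounded_linear])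

locale regression =
  fixes A :: "real^'n^('n::finite)" and xhat :: "'N::finite \<Rightarrow> (real, 'm::{finite,linorder}) vec" and v :: "'N \<Rightarrow> 'n"
    and eps a :: real
  assumes sym_A: "transpose A = A" and nonneg_A: "\<And>i j. A $ i $ j \<ge> 0" and surj_v: "surj v" and a_pos: "a > 0"
begin

definition loss :: "(real, 'm) vec \<Rightarrow> (real, 'm) vec \<Rightarrow> real" where
  "loss x \<xi> = a * (\<xi> $ last_index - last_to_one \<xi> \<bullet> x)\<^sup>2"

definition Lap :: "real^'n^'n" where "Lap = laplacian A"
definition LapK :: "real^('n \<times> 'm)^('n \<times> 'm)" where "LapK = laplacian A \<otimes>\<^sub>K (mat 1 :: ((real, 'm) vec, 'm) vec)"

definition Cset :: "((real^('n \<times> 'm)) \<times> (real^'n)) set" where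
  "Cset = {(xv, lv). (\<forall>i. lv $ i \<ge> 0) \<and> (\<forall>i. lv $ i \<ge> a * (norm (last_to_one (block xv i)))\<^sup>2)}"

abbreviation "Laug \<equiv> L_aug A loss xhat v eps"

definition gradx :: "real^('n \<times> 'm) \<Rightarrow> real^('n \<times> 'm) \<Rightarrow> ((real, 'm) vec, 'N) vec \<Rightarrow> real^('n \<times> 'm)" where
  "gradx x eta xi = (1 / real CARD('N)) *\<^sub>R
     (\<Sum>k\<in>UNIV. lift_block (v k) ((- 2 * a * residual (block x (v k)) (xi $ k)) *\<^sub>R last_to_one (xi $ k)))
     + LapK *v eta + LapK *v x"

definition gradl :: "real^'n \<Rightarrow> real^'n \<Rightarrow> ((real, 'm) vec, 'N) vec \<Rightarrow> real^'n" where
  "gradl l nu xi = (eps\<^sup>2 / real CARD('n)) *\<^sub>R vec 1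
     - (1 / real CARD('N)) *\<^sub>R (\<Sum>k\<in>UNIV. axis (v k) ((norm (xi $ k - xhat k))\<^sup>2))
     + Lap *v nu + Lap *v l"

definition gradxi :: "real^('n \<times> 'm) \<Rightarrow> real^'n \<Rightarrow> ((real, 'm) vec, 'N) vec \<Rightarrow> ((real, 'm) vec, 'N) vec" where
  "gradxi x l xi = (\<chi> k. (1 / real CARD('N)) *\<^sub>R
     ((2 * a * residual (block x (v k)) (xi $ k)) *\<^sub>R residual_slope (block x (v k))
      - (2 * l $ v k) *\<^sub>R (xi $ k - xhat k)))"

text \<open>
  The Lagrangian is exactly quadratic in \<open>(x, \<lambda>)\<close> and in \<open>(\<nu>, \<eta>, \<xi>)\<close>; \<open>remP\<close> and \<open>remQ\<close> are the
  second-order terms.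
\<close>

definition remP :: "real^('n \<times> 'm) \<Rightarrow> real^'n \<Rightarrow> ((real, 'm) vec, 'N) vec \<Rightarrow> real" where
  "remP hx hl xi = 1 / real CARD('N) * (\<Sum>k\<in>UNIV. a * (last_to_one (xi $ k) \<bullet> block hx (v k))\<^sup>2)
     + 1/2 * (hx \<bullet> (LapK *v hx)) + 1/2 * (hl \<bullet> (Lap *v hl))"

definition remQ :: "real^('n \<times> 'm) \<Rightarrow> real^'n \<Rightarrow> ((real, 'm) vec, 'N) vec \<Rightarrow> real" where
  "remQ x l h = 1 / real CARD('N) *
     (\<Sum>k\<in>UNIV. a * (residual_slope (block x (v k)) \<bullet> h $ k)\<^sup>2 - l $ v k * (norm (h $ k))\<^sup>2)"

lemma Laug_eq: "Laug x l nu eta xi = h_fun eps l +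
     1 / real CARD('N) * (\<Sum>k\<in>UNIV. a * (residual (block x (v k)) (xi $ k))\<^sup>2 - l $ v k * (norm (xi $ k - xhat k))\<^sup>2)
     + nu \<bullet> (Lap *v l) + eta \<bullet> (LapK *v x) + 1/2 * (x \<bullet> (LapK *v x)) + 1/2 * (l \<bullet> (Lap *v l))"
  by (simp add: L_aug_def g_fun_def loss_def Lap_def LapK_def residual_def)

lemma transpose_Lap: "transpose Lap = Lap"
  unfolding Lap_def by (rule transpose_laplacian[OF sym_A])

lemma transpose_LapK: "transpose LapK = LapK"
  unfolding LapK_def by (simp add: transpose_kron transpose_laplacian[OF sym_A])

lemmas inner_Lap = inner_matrix_vector_symmetric[OF transpose_Lap]
lemmas inner_LapK = inner_matrix_vector_symmetric[OF transpose_LapK]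

lemma Lap_psd: "x \<bullet> (Lap *v x) \<ge> 0"
  unfolding Lap_def by (rule laplacian_psd[OF sym_A nonneg_A])

lemma LapK_psd: "x \<bullet> (LapK *v x) \<ge> 0"
  unfolding LapK_def by (rule kron_mat_1_psd[OF laplacian_psd[OF sym_A nonneg_A]])

text \<open>x and \<lambda> enter each sample term additively, so there is no mixed term and the
  remainder is a sum of nonnegative forms independent of the base point. The same identity yields
  the gradients, convexity and the first-order conditions.\<close>

lemma expand_P: "Laug (x + hx) (l + hl) nu eta xi
    = Laug x l nu eta xi + (gradx x eta xi \<bullet> hx + gradl l nu xi \<bullet> hl) + remP hx hl xi"
proof -
  have 1: "gradx x eta xi \<bullet> hx = 1 / real CARD('N) *
      (\<Sum>k\<in>UNIV. - 2 * a * residual (block x (v k)) (xi $ k) * (last_to_one (xi $ k) \<bullet> block hx (v k)))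
      + eta \<bullet> (LapK *v hx) + x \<bullet> (LapK *v hx)"
    by (simp add: gradx_def inner_add_left inner_sum_left inner_lift_block inner_LapK)
  have 2: "gradl l nu xi \<bullet> hl = eps\<^sup>2 / real CARD('n) * (vec 1 \<bullet> hl) - 1 / real CARD('N) *
      (\<Sum>k\<in>UNIV. hl $ v k * (norm (xi $ k - xhat k))\<^sup>2) + nu \<bullet> (Lap *v hl) + l \<bullet> (Lap *v hl)"
    by (simp add: gradl_def inner_add_left inner_diff_left inner_sum_left inner_axis' inner_Lap mult.commute)
  have 3: "(\<Sum>k\<in>UNIV. a * (residual (block (x + hx) (v k)) (xi $ k))\<^sup>2 - (l + hl) $ v k * (norm (xi $ k - xhat k))\<^sup>2)
     = (\<Sum>k\<in>UNIV. a * (residual (block x (v k)) (xi $ k))\<^sup>2 - l $ v k * (norm (xi $ k - xhat k))\<^sup>2)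
     + (\<Sum>k\<in>UNIV. - 2 * a * residual (block x (v k)) (xi $ k) * (last_to_one (xi $ k) \<bullet> block hx (v k)))
     - (\<Sum>k\<in>UNIV. hl $ v k * (norm (xi $ k - xhat k))\<^sup>2)
     + (\<Sum>k\<in>UNIV. a * (last_to_one (xi $ k) \<bullet> block hx (v k))\<^sup>2)"
    unfolding sum.distrib[symmetric] sum_subtractf[symmetric]
    by (intro sum.cong refl, simp only: block_simps residual_add_left vector_add_component)
       (simp add: power2_eq_square algebra_simps)
  have 4: "(x + hx) \<bullet> (LapK *v (x + hx)) = x \<bullet> (LapK *v x) + 2 * (x \<bullet> (LapK *v hx)) + hx \<bullet> (LapK *v hx)"
    using inner_LapK[of hx x]
    by (simp add: matrix_vector_right_distrib inner_add_left inner_add_right inner_commute)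
  have 5: "(l + hl) \<bullet> (Lap *v (l + hl)) = l \<bullet> (Lap *v l) + 2 * (l \<bullet> (Lap *v hl)) + hl \<bullet> (Lap *v hl)"
    using inner_Lap[of hl l]
    by (simp add: matrix_vector_right_distrib inner_add_left inner_add_right inner_commute)
  have 6: "h_fun eps (l + hl) = h_fun eps l + eps\<^sup>2 / real CARD('n) * (vec 1 \<bullet> hl)"
    by (simp add: h_fun_def inner_add_right field_simps)
  show ?thesis
    unfolding Laug_eq 1 2 3 4 5 6 remP_def
    by (simp add: matrix_vector_right_distrib inner_add_right distrib_left right_diff_distrib add_divide_distrib diff_divide_distrib)
qed

text \<open>\<nu> and \<eta> enter linearly and the residual is affine in \<xi>, so only the \<xi>
  increment appears to second order. Its coefficients depend on (x, \<lambda>), and their sign is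
  what \<open>Cset\<close> controls.\<close>

lemma expand_Q: "Laug x l (nu + hnu) (eta + heta) (xi + hxi)
    = Laug x l nu eta xi + ((Lap *v l) \<bullet> hnu + (LapK *v x) \<bullet> heta + gradxi x l xi \<bullet> hxi) + remQ x l hxi"
proof -
  have 1: "gradxi x l xi \<bullet> hxi = 1 / real CARD('N) *
      (\<Sum>k\<in>UNIV. 2 * a * residual (block x (v k)) (xi $ k) * (residual_slope (block x (v k)) \<bullet> hxi $ k)
         - 2 * l $ v k * ((xi $ k - xhat k) \<bullet> hxi $ k))"
    by (simp add: gradxi_def inner_vec_def[of _ hxi] inner_diff_left sum_distrib_left)
  have 2: "(\<Sum>k\<in>UNIV. a * (residual (block x (v k)) ((xi + hxi) $ k))\<^sup>2 - l $ v k * (norm ((xi + hxi) $ k - xhat k))\<^sup>2)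
     = (\<Sum>k\<in>UNIV. a * (residual (block x (v k)) (xi $ k))\<^sup>2 - l $ v k * (norm (xi $ k - xhat k))\<^sup>2)
     + (\<Sum>k\<in>UNIV. 2 * a * residual (block x (v k)) (xi $ k) * (residual_slope (block x (v k)) \<bullet> hxi $ k)
         - 2 * l $ v k * ((xi $ k - xhat k) \<bullet> hxi $ k))
     + (\<Sum>k\<in>UNIV. a * (residual_slope (block x (v k)) \<bullet> hxi $ k)\<^sup>2 - l $ v k * (norm (hxi $ k))\<^sup>2)"
    unfolding sum.distrib[symmetric]
  proof (intro sum.cong refl)
    fix k
    have "(norm ((xi + hxi) $ k - xhat k))\<^sup>2
        = (norm (xi $ k - xhat k))\<^sup>2 + 2 * ((xi $ k - xhat k) \<bullet> hxi $ k) + (norm (hxi $ k))\<^sup>2"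
      using dot_norm[of "xi $ k - xhat k" "hxi $ k"] by (simp add: algebra_simps)
    then show "a * (residual (block x (v k)) ((xi + hxi) $ k))\<^sup>2 - l $ v k * (norm ((xi + hxi) $ k - xhat k))\<^sup>2
      = a * (residual (block x (v k)) (xi $ k))\<^sup>2 - l $ v k * (norm (xi $ k - xhat k))\<^sup>2
      + (2 * a * residual (block x (v k)) (xi $ k) * (residual_slope (block x (v k)) \<bullet> hxi $ k)
         - 2 * l $ v k * ((xi $ k - xhat k) \<bullet> hxi $ k))
      + (a * (residual_slope (block x (v k)) \<bullet> hxi $ k)\<^sup>2 - l $ v k * (norm (hxi $ k))\<^sup>2)"
      by (simp only: vector_add_component residual_add_right) (simp add: power2_eq_square algebra_simps)
  qed
  show ?thesis
    unfolding Laug_eq 1 2 remQ_def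
    by (simp add: inner_add_left inner_commute distrib_left add_divide_distrib)
qed

lemma remP_scale: "remP (c *\<^sub>R hx) (c *\<^sub>R hl) xi = c\<^sup>2 * remP hx hl xi"
  by (simp add: remP_def matrix_vector_mult_scaleR power_mult_distrib sum_distrib_left power2_eq_square algebra_simps)

lemma remQ_scale: "remQ x l (c *\<^sub>R h) = c\<^sup>2 * remQ x l h"
  unfolding remQ_def sum_distrib_left by (intro sum.cong refl) (simp add: power_mult_distrib algebra_simps)

lemma remP_nonneg: "remP hx hl xi \<ge> 0"
  unfolding remP_def using LapK_psd[of hx] Lap_psd[of hl] a_pos
  by (intro add_nonneg_nonneg mult_nonneg_nonneg sum_nonneg) auto

text \<open>Cauchy-Schwarz and \<open>norm_residual_slope\<close>. The coefficients are the slacks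
  in the constraints of \<open>Cset\<close>: nonnegative slacks give concavity, positive ones give
  control of the increment in \<xi>.\<close>

lemma remQ_le: "remQ x l h \<le> - (1 / real CARD('N) *
    (\<Sum>k\<in>UNIV. (l $ v k - a * (norm (last_to_one (block x (v k))))\<^sup>2) * (norm (h $ k))\<^sup>2))"
proof -
  have "a * (residual_slope (block x (v k)) \<bullet> h $ k)\<^sup>2 - l $ v k * (norm (h $ k))\<^sup>2
     \<le> - ((l $ v k - a * (norm (last_to_one (block x (v k))))\<^sup>2) * (norm (h $ k))\<^sup>2)" for k
  proof -
    have "(residual_slope (block x (v k)) \<bullet> h $ k)\<^sup>2 \<le> (norm (last_to_one (block x (v k))))\<^sup>2 * (norm (h $ k))\<^sup>2"
      using power_mono[OF Cauchy_Schwarz_ineq2[of "residual_slope (block x (v k))" "h $ k"] abs_ge_zero, of 2]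
      by (simp add: power_mult_distrib norm_residual_slope)
    then show ?thesis
      using mult_left_mono[OF _ less_imp_le[OF a_pos]] by (fastforce simp: algebra_simps)
  qed
  then show ?thesis
    unfolding remQ_def minus_mult_right sum_negf[symmetric]
    by (intro mult_left_mono sum_mono) auto
qed

lemma gradient_x: "gradient (\<lambda>z. Laug z l nu eta xi) x = gradx x eta xi"
proof (rule gradient_eqI[where R = "\<lambda>h. remP h 0 xi"])
  show "Laug (x + h) l nu eta xi = Laug x l nu eta xi + gradx x eta xi \<bullet> h + remP h 0 xi" for h
    using expand_P[of x h l 0] by simp
  show "continuous_on UNIV (\<lambda>h. remP h 0 xi)"
    unfolding remP_def by (intro continuous_intros)
  show "remP (c *\<^sub>R h) 0 xi = c\<^sup>2 * remP h 0 xi" for c h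
    using remP_scale[of c h 0] by simp
qed

lemma gradient_l: "gradient (\<lambda>z. Laug x z nu eta xi) l = gradl l nu xi"
proof (rule gradient_eqI[where R = "\<lambda>h. remP 0 h xi"])
  show "Laug x (l + h) nu eta xi = Laug x l nu eta xi + gradl l nu xi \<bullet> h + remP 0 h xi" for h
    using expand_P[of x 0 l h] by simp
  show "continuous_on UNIV (\<lambda>h. remP 0 h xi)"
    unfolding remP_def by (intro continuous_intros)
  show "remP 0 (c *\<^sub>R h) xi = c\<^sup>2 * remP 0 h xi" for c h
    using remP_scale[of c 0 h] by simp
qed

lemma remQ_0 [simp]: "remQ x l 0 = 0"
  by (simp add: remQ_def)

lemma gradient_nu: "gradient (\<lambda>z. Laug x l z eta xi) nu = Lap *v l"
  using expand_Q[of x l nu _ eta 0 xi 0] by (intro gradient_eqI[where R = "\<lambda>_. 0"]) auto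

lemma gradient_eta: "gradient (\<lambda>z. Laug x l nu z xi) eta = LapK *v x"
  using expand_Q[of x l nu 0 eta _ xi 0] by (intro gradient_eqI[where R = "\<lambda>_. 0"]) auto

lemma gradient_xi: "gradient (\<lambda>z. Laug x l nu eta (\<chi> j. if j = k then z else xi $ j)) (xi $ k) = gradxi x l xi $ k"
proof (rule gradient_eqI[where R = "\<lambda>h. remQ x l (axis k h)"])
  \<comment> \<open>Varying a single sample vector is adding an increment supported at k, so the
    joint expansion covers the partial gradient.\<close>
  have *: "(\<chi> j. if j = k then xi $ k + h else xi $ j) = xi + axis k h" for h
    by (simp add: vec_eq_iff axis_def)
  show "Laug x l nu eta (\<chi> j. if j = k then xi $ k + h else xi $ j)
     = Laug x l nu eta (\<chi> j. if j = k then xi $ k else xi $ j) + gradxi x l xi $ k \<bullet> h + remQ x l (axis k h)" for h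
  proof -
    have "(\<chi> j. if j = k then xi $ k else xi $ j) = xi" by (simp add: vec_eq_iff)
    then show ?thesis
      using expand_Q[of x l nu 0 eta 0 xi "axis k h"] *[of h] by (simp add: inner_axis)
  qed
  have c: "continuous_on UNIV (\<lambda>h :: (real, 'm) vec. axis k h $ j)" for j
    by (cases "j = k") (auto simp: axis_def intro!: continuous_intros)
  have "continuous_on UNIV (\<lambda>h :: (real, 'm) vec. \<chi> j. axis k h $ j)"
    by (intro continuous_on_vec_lambda c)
  then have "continuous_on UNIV (\<lambda>h :: (real, 'm) vec. axis k h)"
    by (simp only: vec_lambda_eta)
  then show "continuous_on UNIV (\<lambda>h. remQ x l (axis k h))"
    unfolding remQ_def by (intro continuous_intros)
  have "axis k (c *\<^sub>R h) = c *\<^sub>R axis k h" for c and h :: "(real, 'm) vec"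
    by (simp add: vec_eq_iff axis_def)
  then show "remQ x l (axis k (c *\<^sub>R h)) = c\<^sup>2 * remQ x l (axis k h)" for c h
    by (simp add: remQ_scale)
qed

end

lemma tendsto_inner_bounded:
  fixes y z :: "'b \<Rightarrow> 'a::real_inner"
  assumes y: "(y \<longlongrightarrow> 0) F" and z: "\<forall>\<^sub>F t in F. norm (z t) \<le> B"
  shows "((\<lambda>t. y t \<bullet> z t) \<longlongrightarrow> 0) F"
proof (rule Lim_null_comparison)
  have "((\<lambda>t. norm (y t) * B) \<longlongrightarrow> norm (0 :: 'a) * B) F" by (intro tendsto_intros y)
  then show "((\<lambda>t. norm (y t) * B) \<longlongrightarrow> 0) F" by simp
  show "\<forall>\<^sub>F t in F. norm (y t \<bullet> z t) \<le> norm (y t) * B"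
    using z
  proof eventually_elim
    case (elim t)
    then show ?case
      using Cauchy_Schwarz_ineq2[of "y t" "z t"] mult_left_mono[of "norm (z t)" B "norm (y t)"] by simp
  qed
qed

lemma tendsto_last_to_one [tendsto_intros]:
  "(g \<longlongrightarrow> y) F \<Longrightarrow> ((\<lambda>t. last_to_one (g t)) \<longlongrightarrow> last_to_one y) F"
  using continuous_on_tendsto_compose[OF continuous_on_last_to_one[OF continuous_on_id[of UNIV]], of g y F] by simp

lemma tendsto_lift_block [tendsto_intros]:
  "(g \<longlongrightarrow> y) F \<Longrightarrow> ((\<lambda>t. lift_block i (g t)) \<longlongrightarrow> lift_block i y) F"
  using continuous_on_tendsto_compose[OF continuous_on_lift_block[OF continuous_on_id[of UNIV]], of g y F] by simp

lemma tendsto_axis [tendsto_intros]: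
  "(g \<longlongrightarrow> y) F \<Longrightarrow> ((\<lambda>t. axis i (g t :: real)) \<longlongrightarrow> axis i y) F"
  using continuous_on_tendsto_compose[OF continuous_on_axis[OF continuous_on_id[of UNIV]], of g y F] by simp

lemma last_to_one_convex_combination:
  "u + w = 1 \<Longrightarrow> last_to_one (u *\<^sub>R x + w *\<^sub>R y) = u *\<^sub>R last_to_one x + w *\<^sub>R last_to_one y"
  by (auto simp: last_to_one_def vec_eq_iff)

lemma norm_block_le: "norm (block x i) \<le> norm x"
proof -
  have "(norm (block x i))\<^sup>2 = lift_block i (block x i) \<bullet> x"
    by (simp add: inner_lift_block power2_norm_eq_inner)
  also have "\<dots> \<le> norm (lift_block i (block x i)) * norm x" by (rule norm_cauchy_schwarz)
  also have "norm (lift_block i (block x i)) = norm (block x i)"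
  proof -
    have "block (lift_block i (block x i)) i = block x i"
      by (simp add: block_def lift_block_def vec_eq_iff)
    then show ?thesis by (simp add: norm_eq_sqrt_inner inner_lift_block)
  qed
  finally show ?thesis by (cases "norm (block x i) = 0") (auto simp: power2_eq_square)
qed

section \<open>The constraint set, first-order conditions, and optimality in problem (D)\<close>

context regression
begin

lemma mem_Cset: "(xv, lv) \<in> Cset \<longleftrightarrow> (\<forall>i. lv $ i \<ge> a * (norm (last_to_one (block xv i)))\<^sup>2)"
proof -
  have "a * (norm (last_to_one (block xv i)))\<^sup>2 \<ge> 0" for i using a_pos by simp
  then show ?thesis unfolding Cset_def by (auto intro: order_trans)
qed

lemma Cset_eq: "Cset = {z. \<forall>i. a * (norm (last_to_one (block (fst z) i)))\<^sup>2 \<le> snd z $ i}"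
  by (auto simp: mem_Cset)

lemma closed_Cset: "closed Cset"
  unfolding Cset_eq
  by (intro closed_Collect_all closed_Collect_le continuous_intros)

text \<open>Each constraint describes the region above the squared norm of an affine map. Since
  \<open>last_to_one\<close> is affine and not linear, the weights must sum to 1.\<close>

lemma convex_Cset: "convex Cset"
proof (rule convexI)
  fix z z' and u w :: real assume z: "z \<in> Cset" "z' \<in> Cset" and uw: "0 \<le> u" "0 \<le> w" "u + w = 1"
  have "a * (norm (last_to_one (block (u *\<^sub>R fst z + w *\<^sub>R fst z') i)))\<^sup>2 \<le> u * snd z $ i + w * snd z' $ i" for i
  proof -
    let ?y = "last_to_one (block (fst z) i)" and ?y' = "last_to_one (block (fst z') i)"
    have "norm (u *\<^sub>R ?y + w *\<^sub>R ?y') \<le> u * norm ?y + w * norm ?y'"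
      using norm_triangle_ineq[of "u *\<^sub>R ?y" "w *\<^sub>R ?y'"] uw by simp
    then have "(norm (u *\<^sub>R ?y + w *\<^sub>R ?y'))\<^sup>2 \<le> (u * norm ?y + w * norm ?y')\<^sup>2"
      by (rule power_mono) simp
    also have "\<dots> \<le> u * (norm ?y)\<^sup>2 + w * (norm ?y')\<^sup>2"
    proof -
      have "u * (norm ?y)\<^sup>2 + w * (norm ?y')\<^sup>2 - (u * norm ?y + w * norm ?y')\<^sup>2 = u * w * (norm ?y - norm ?y')\<^sup>2"
      proof -
        have w: "w = 1 - u" using uw(3) by simp
        show ?thesis unfolding w by (simp add: power2_eq_square algebra_simps)
      qed
      moreover have "\<dots> \<ge> 0" using uw by simp
      ultimately show ?thesis by linarith
    qed
    finally have "a * (norm (u *\<^sub>R ?y + w *\<^sub>R ?y'))\<^sup>2 \<le> a * (u * (norm ?y)\<^sup>2 + w * (norm ?y')\<^sup>2)"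
      using a_pos by simp
    also have "\<dots> = u * (a * (norm ?y)\<^sup>2) + w * (a * (norm ?y')\<^sup>2)" by (simp add: algebra_simps)
    also have "\<dots> \<le> u * snd z $ i + w * snd z' $ i"
      using z uw unfolding Cset_eq by (intro add_mono mult_left_mono) auto
    finally show ?thesis by (simp add: last_to_one_convex_combination[OF uw(3)])
  qed
  then show "u *\<^sub>R z + w *\<^sub>R z' \<in> Cset" by (simp add: Cset_eq)
qed

definition Gp :: "(real^('n \<times> 'm)) \<times> (real^'n) \<Rightarrow> (real^'n) \<times> (real^('n \<times> 'm)) \<times> ((real, 'm) vec, 'N) vec
    \<Rightarrow> (real^('n \<times> 'm)) \<times> (real^'n)" where
  "Gp P Q = (gradx (fst P) (fst (snd Q)) (snd (snd Q)), gradl (snd P) (fst Q) (snd (snd Q)))"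

definition Gq :: "(real^('n \<times> 'm)) \<times> (real^'n) \<Rightarrow> (real^'n) \<times> (real^('n \<times> 'm)) \<times> ((real, 'm) vec, 'N) vec
    \<Rightarrow> (real^'n) \<times> (real^('n \<times> 'm)) \<times> ((real, 'm) vec, 'N) vec" where
  "Gq P Q = (Lap *v snd P, LapK *v fst P, gradxi (fst P) (snd P) (snd (snd Q)))"

definition LPQ :: "(real^('n \<times> 'm)) \<times> (real^'n) \<Rightarrow> (real^'n) \<times> (real^('n \<times> 'm)) \<times> ((real, 'm) vec, 'N) vec \<Rightarrow> real" where
  "LPQ = (\<lambda>(xv, lv) (nu, eta, xi). Laug xv lv nu eta xi)"

lemma LPQ_add_left: "LPQ (P + h) Q = LPQ P Q + Gp P Q \<bullet> h + remP (fst h) (snd h) (snd (snd Q))"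
  using expand_P[of "fst P" "fst h" "snd P" "snd h" "fst Q" "fst (snd Q)" "snd (snd Q)"]
  by (simp add: LPQ_def case_prod_unfold Gp_def inner_prod_def)

lemma LPQ_add_right: "LPQ P (Q + h) = LPQ P Q + Gq P Q \<bullet> h + remQ (fst P) (snd P) (snd (snd h))"
  using expand_Q[of "fst P" "snd P" "fst Q" "fst h" "fst (snd Q)" "fst (snd h)" "snd (snd Q)" "snd (snd h)"]
  by (simp add: LPQ_def case_prod_unfold Gq_def inner_prod_def)

lemma LPQ_convex: "Gp P Q \<bullet> (R - P) \<le> LPQ R Q - LPQ P Q"
  using LPQ_add_left[of P "R - P" Q] remP_nonneg[of "fst (R - P)" "snd (R - P)" "snd (snd Q)"] by simp

lemma remQ_nonpos: "(x, l) \<in> Cset \<Longrightarrow> remQ x l h \<le> 0"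
  by (rule order_trans[OF remQ_le]) (auto simp: mem_Cset intro!: divide_nonneg_nonneg sum_nonneg)

lemma LPQ_concave: "P \<in> Cset \<Longrightarrow> LPQ P R - LPQ P Q \<le> Gq P Q \<bullet> (R - Q)"
  using LPQ_add_right[of P Q "R - Q"] remQ_nonpos[of "fst P" "snd P" "snd (snd (R - Q))"] by simp

lemma continuous_LPQ: "continuous_on UNIV (\<lambda>z. LPQ (fst z) (snd z))"
  unfolding LPQ_def case_prod_unfold Laug_eq h_fun_def by (intro continuous_intros) auto

lemma continuous_Gp: "continuous_on UNIV (\<lambda>z. Gp (fst z) (snd z))"
  unfolding Gp_def gradx_def gradl_def by (intro continuous_intros) auto

lemma continuous_Gq: "continuous_on UNIV (\<lambda>z. Gq (fst z) (snd z))"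
  unfolding Gq_def gradxi_def by (intro continuous_intros continuous_on_vec_lambda) auto

lemma saddle_L_aug_iff: "saddle_L_aug A loss xhat v eps Cset P Q \<longleftrightarrow> saddle_point LPQ Cset UNIV P Q"
  unfolding saddle_L_aug_def LPQ_def ..

text \<open>The second argument is unconstrained, so a saddle point is a free maximum in it. In
  particular the Laplacian images of its x and \<lambda> vanish.\<close>

lemma saddle_imp_Gq_eq_0:
  assumes "saddle_point LPQ Cset UNIV P Q"
  shows "Gq P Q = 0"
proof -
  have "- Gq P Q = 0"
  proof (rule quadratic_local_min_imp_critical[where e = 1 and R = "\<lambda>h. - remQ (fst P) (snd P) (snd (snd h))"])
    fix h
    have "LPQ P (Q + h) \<le> LPQ P Q" using assms by (simp add: saddle_point_def del: split_paired_All)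
    then show "0 \<le> - Gq P Q \<bullet> h + - remQ (fst P) (snd P) (snd (snd h))"
      using LPQ_add_right[of P Q h] by simp
  qed (simp_all add: remQ_scale)
  then show ?thesis by simp
qed

lemma interior_saddle_imp_Gp_eq_0:
  assumes "saddle_point LPQ Cset UNIV P Q" and "P \<in> interior Cset"
  shows "Gp P Q = 0"
proof -
  obtain e where e: "e > 0" "ball P e \<subseteq> Cset" using assms(2) by (auto simp: mem_interior)
  show ?thesis
  proof (rule quadratic_local_min_imp_critical[OF e(1), where R = "\<lambda>h. remP (fst h) (snd h) (snd (snd Q))"])
    fix h :: "(real^('n \<times> 'm)) \<times> (real^'n)" assume "norm h < e"
    then have "P + h \<in> Cset" using e(2) by (auto simp: dist_norm)
    then have "LPQ P Q \<le> LPQ (P + h) Q" using assms(1) by (simp add: saddle_point_def)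
    then show "0 \<le> Gp P Q \<bullet> h + remP (fst h) (snd h) (snd (snd Q))"
      using LPQ_add_left[of P h Q] by simp
  qed (simp add: remP_scale)
qed

text \<open>Lowering only the i-th multiplier by a small amount stays in the set, while the
  right-hand side is unchanged.\<close>

lemma interior_Cset_strict:
  assumes "(x, l) \<in> interior Cset"
  shows "l $ i > a * (norm (last_to_one (block x i)))\<^sup>2"
proof -
  obtain e where e: "e > 0" "ball (x, l) e \<subseteq> Cset" using assms by (auto simp: mem_interior)
  have "(x, l - (e/2) *\<^sub>R axis i 1) \<in> ball (x, l) e"
    using e(1) by (simp add: dist_norm norm_Pair)
  with e(2) have "(x, l - (e/2) *\<^sub>R axis i 1) \<in> Cset" by blast
  then have "l $ i - e / 2 \<ge> a * (norm (last_to_one (block x i)))\<^sup>2"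
    unfolding mem_Cset by (auto dest!: spec[of _ i])
  with e(1) show ?thesis by simp
qed

text \<open>At a saddle point the Laplacian terms vanish and each \<xi> maximizes its own sample
  term, so the saddle value is the objective of (D). The saddle inequality handles feasible
  competitors in \<open>Cset\<close>; for the others an inner supremum is infinite.\<close>

lemma saddle_imp_optimizer_D:
  assumes sad: "saddle_point LPQ Cset UNIV P Q"
  shows "optimizer_D A loss xhat v eps P"
proof -
  obtain x l where P: "P = (x, l)" by (cases P)
  obtain nu eta xi where Q: "Q = (nu, eta, xi)" by (cases Q) auto
  have zero: "Lap *v l = 0" "LapK *v x = 0"
    using saddle_imp_Gq_eq_0[OF sad] by (simp_all add: Gq_def P zero_prod_def)
  have PC: "(x, l) \<in> Cset" using sad by (simp add: saddle_point_def P)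
  have feas: "feasible_D A P"
    using PC zero by (auto simp: feasible_D_def P Cset_def Lap_def LapK_def)
  define obj where "obj = objective_D loss xhat v eps"
  have max_xi: "g_fun loss xhat k (block x (v k)) (l $ v k) \<xi> \<le> g_fun loss xhat k (block x (v k)) (l $ v k) (xi $ k)" for k \<xi>
  proof -
    \<comment> \<open>Changing one sample vector only lets the comparison of whole sums isolate the
      k-th summand.\<close>
    let ?xi' = "\<chi> j. if j = k then \<xi> else xi $ j"
    have "LPQ P (nu, eta, ?xi') \<le> LPQ P Q" using sad by (simp add: saddle_point_def)
    then have "(\<Sum>j\<in>UNIV. g_fun loss xhat j (block x (v j)) (l $ v j) (?xi' $ j))
       \<le> (\<Sum>j\<in>UNIV. g_fun loss xhat j (block x (v j)) (l $ v j) (xi $ j))"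
      by (simp add: LPQ_def P Q L_aug_def divide_le_cancel)
    moreover have "(\<Sum>j\<in>UNIV - {k}. g_fun loss xhat j (block x (v j)) (l $ v j) (?xi' $ j))
       = (\<Sum>j\<in>UNIV - {k}. g_fun loss xhat j (block x (v j)) (l $ v j) (xi $ j))"
      by (intro sum.cong) auto
    ultimately show ?thesis
      by (simp add: sum.remove[of UNIV k])
  qed
  have obj_P: "obj P = ereal (LPQ P Q)"
  proof -
    have "(SUP \<xi>. ereal (g_fun loss xhat k (block x (v k)) (l $ v k) \<xi>))
        = ereal (g_fun loss xhat k (block x (v k)) (l $ v k) (xi $ k))" for k
      by (intro antisym SUP_least SUP_upper) (use max_xi in auto)
    then show ?thesis
      using zero by (simp add: obj_def objective_D_def LPQ_def P Q L_aug_def Lap_def LapK_def)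
  qed
  have ge: "obj P \<le> obj P'" if P': "feasible_D A P'" for P'
  proof -
    obtain x' l' where P'_def: "P' = (x', l')" by (cases P')
    have zero': "Lap *v l' = 0" "LapK *v x' = 0" and l'0: "\<And>i. l' $ i \<ge> 0"
      using P' by (auto simp: feasible_D_def P'_def Lap_def LapK_def)
    let ?G = "\<lambda>k \<xi>. g_fun loss xhat k (block x' (v k)) (l' $ v k) \<xi>"
    have sup: "ereal (?G k \<xi>) \<le> (SUP \<xi>. ereal (?G k \<xi>))" for k \<xi> by (rule SUP_upper) simp
    show ?thesis
    proof (cases "P' \<in> Cset")
      case True
      then have "obj P \<le> ereal (LPQ P' Q)"
        using sad by (simp add: obj_P saddle_point_def)
      also have "\<dots> = ereal (h_fun eps l') + ereal (1 / real CARD('N)) * (\<Sum>k\<in>UNIV. ereal (?G k (xi $ k)))"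
        using zero' by (simp add: LPQ_def P'_def Q L_aug_def Lap_def LapK_def)
      also have "\<dots> \<le> obj P'"
        unfolding obj_def objective_D_def P'_def case_prod_conv
        by (intro add_left_mono ereal_mult_left_mono sum_mono sup) auto
      finally show ?thesis .
    next
      case False
      then obtain i where i: "l' $ i < a * (norm (last_to_one (block x' i)))\<^sup>2"
        by (auto simp: P'_def mem_Cset not_le)
      \<comment> \<open>Agent i holds a sample, so its violated constraint is felt by the
        objective.\<close>
      obtain k where k: "v k = i" using surj_v by (metis surjD)
      \<comment> \<open>From the sample, moving along the gradient of the residual makes the sample
        term a quadratic in s with positive leading coefficient
        \<open>c * (norm ?w)\<^sup>2\<close>.\<close>
      let ?w = "residual_slope (block x' i)"
      define c where "c = a * (norm ?w)\<^sup>2 - l' $ i"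
      have c: "c > 0" using i by (simp add: c_def norm_residual_slope)
      have w: "norm ?w > 0"
      proof (rule ccontr)
        assume "\<not> norm ?w > 0"
        then have "norm ?w = 0" by simp
        with c l'0[of i] show False by (simp add: c_def)
      qed
      define \<rho> where "\<rho> = residual (block x' i) (xhat k)"
      have G: "?G k (xhat k + s *\<^sub>R ?w) = a * \<rho>\<^sup>2 + s * (2 * a * \<rho> * (norm ?w)\<^sup>2) + s\<^sup>2 * (c * (norm ?w)\<^sup>2)" for s
        unfolding g_fun_def loss_def residual_def[symmetric] residual_add_right k \<rho>_def[symmetric] c_def
        by (simp add: power_mult_distrib power2_norm_eq_inner) (simp add: power2_eq_square algebra_simps)
      have inf: "(SUP \<xi>. ereal (?G k \<xi>)) = \<infinity>"
      proof (rule ereal_top)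
        fix B :: real
        \<comment> \<open>The quotient lets one factor s of the quadratic term outweigh both the
          linear coefficient and B; s at least 1 keeps |B| below s |B|.\<close>
        define s where "s = max 1 ((\<bar>B\<bar> + \<bar>2 * a * \<rho> * (norm ?w)\<^sup>2\<bar>) / (c * (norm ?w)\<^sup>2))"
        let ?b = "2 * a * \<rho> * (norm ?w)\<^sup>2" and ?d = "c * (norm ?w)\<^sup>2"
        have d: "?d > 0" using c w by simp
        have s: "s \<ge> 1" "s * ?d \<ge> \<bar>B\<bar> + \<bar>?b\<bar>"
          using d by (auto simp: s_def pos_divide_le_eq[symmetric])
        have "B \<le> s * \<bar>B\<bar>" using s(1) mult_right_mono[of 1 s "\<bar>B\<bar>"] by simp
        also have "\<dots> \<le> s * (?b + s * ?d)" using s by (intro mult_left_mono) auto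
        also have "\<dots> \<le> a * \<rho>\<^sup>2 + s * ?b + s\<^sup>2 * ?d"
          using mult_nonneg_nonneg[OF less_imp_le[OF a_pos] zero_le_power2[of \<rho>]]
          by (simp add: power2_eq_square algebra_simps)
        finally have "ereal B \<le> ereal (?G k (xhat k + s *\<^sub>R ?w))" unfolding G by simp
        also have "\<dots> \<le> (SUP \<xi>. ereal (?G k \<xi>))" by (rule sup)
        finally show "ereal B \<le> (SUP \<xi>. ereal (?G k \<xi>))" .
      qed
      have ninf: "(SUP \<xi>. ereal (?G k \<xi>)) \<noteq> - \<infinity>" for k
        using sup[of k 0] by auto
      \<comment> \<open>One infinite supremum decides the sum, because none of the others is
        negative infinity.\<close>
      have "(\<Sum>k\<in>UNIV. SUP \<xi>. ereal (?G k \<xi>)) = \<infinity>"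
        using inf ninf by (subst sum_Pinfty) auto
      then have "obj P' = \<infinity>"
        unfolding obj_def objective_D_def P'_def case_prod_conv by simp
      then show ?thesis by simp
    qed
  qed
  show ?thesis
    unfolding optimizer_D_def is_arg_min_def obj_def[symmetric]
    using feas ge by (auto simp: not_less)
qed

end

section \<open>From trajectories of (SP) to convergence\<close>

lemma tendsto_0_of_square_le:
  fixes f :: "'b \<Rightarrow> 'a::real_normed_vector"
  assumes le: "\<forall>\<^sub>F t in F. (norm (f t))\<^sup>2 \<le> c * g t" and lim: "(g \<longlongrightarrow> (0::real)) F"
  shows "(f \<longlongrightarrow> 0) F"
proof (rule Lim_null_comparison)
  have "((\<lambda>t. sqrt (c * g t)) \<longlongrightarrow> sqrt (c * 0)) F" by (intro tendsto_intros lim)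
  then show "((\<lambda>t. sqrt (c * g t)) \<longlongrightarrow> 0) F" by simp
  show "\<forall>\<^sub>F t in F. norm (f t) \<le> sqrt (c * g t)"
    using le by eventually_elim (rule real_le_rsqrt)
qed

lemma has_vector_derivative_vec:
  fixes y :: "real \<Rightarrow> (real^'m)^'N"
  assumes "\<And>k. ((\<lambda>s. y s $ k) has_vector_derivative D $ k) (at t within S)"
  shows "(y has_vector_derivative D) (at t within S)"
proof -
  have lin: "bounded_linear (axis k :: real^'m \<Rightarrow> (real^'m)^'N)" for k
    by (simp add: linear_conv_bounded_linear[symmetric]) (auto intro!: linearI simp: axis_def vec_eq_iff)
  have sum: "(\<Sum>k\<in>UNIV. axis k (z $ k)) = z" for z :: "(real^'m)^'N"
    by (simp add: vec_eq_iff axis_def)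
  have "((\<lambda>s. \<Sum>k\<in>UNIV. axis k (y s $ k)) has_vector_derivative (\<Sum>k\<in>UNIV. axis k (D $ k))) (at t within S)"
    by (intro has_vector_derivative_sum bounded_linear.has_vector_derivative[OF lin] assms)
  then show ?thesis by (simp only: sum)
qed

context regression
begin

lemma SP_trajectory_imp_flow:
  assumes traj: "SP_trajectory A loss xhat v eps Cset xv lv nu eta xi" and init: "(xv 0, lv 0) \<in> Cset"
  obtains S where "projected_saddle_flow Cset LPQ Gp Gq (\<lambda>t. (xv t, lv t)) (\<lambda>t. (nu t, eta t, xi t)) S"
proof -
  define good where "good t \<longleftrightarrow> t \<ge> 0 \<longrightarrow>
         (\<exists>u. is_projected_vector Cset (xv t, lv t) (- Gp (xv t, lv t) (nu t, eta t, xi t)) u \<and>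
              ((\<lambda>s. (xv s, lv s)) has_vector_derivative u) (at t within {0..})) \<and>
         ((\<lambda>t. (nu t, eta t, xi t)) has_vector_derivative Gq (xv t, lv t) (nu t, eta t, xi t)) (at t within {0..})" for t
  have "AE t in lebesgue. good t"
    using traj unfolding SP_trajectory_def Let_def gradient_x gradient_l gradient_nu gradient_eta gradient_xi
    by (auto simp: good_def Gp_def Gq_def elim!: eventually_mono
        intro!: has_vector_derivative_Pair has_vector_derivative_vec)
  then obtain S where S: "S \<in> null_sets lebesgue" "{t. \<not> good t} \<subseteq> S"
    unfolding eventually_ae_filter by auto
  have good: "good t" if "t \<notin> S" for t using S(2) that by blast
  \<comment> \<open>Closest points lie in the set only if it is nonempty; the initial state provides
    a witness.\<close>
  have ne: "Cset \<noteq> {}" using init by blast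
  have "projected_saddle_flow Cset LPQ Gp Gq (\<lambda>t. (xv t, lv t)) (\<lambda>t. (nu t, eta t, xi t)) S"
  proof
    show "negligible S" using S(1) by (simp add: negligible_iff_null_sets)
    show "abs_continuous_on 0 T (\<lambda>t. ((xv t, lv t), (nu t, eta t, xi t)))" if "T \<ge> 0" for T
    \<comment> \<open>Regrouping the components into the pair (p, q) leaves the norm of increments
      unchanged.\<close>
    proof (rule abs_continuous_on_dominated[where K = 1 and M = 0])
      show "abs_continuous_on 0 T (\<lambda>t. (xv t, lv t, nu t, eta t, xi t))"
        using traj that by (simp add: SP_trajectory_def Let_def)
    qed (simp add: norm_Pair)
    fix t :: real assume t: "t \<ge> 0" "t \<notin> S"
    from good[OF t(2)] t(1) obtain u where u: "is_projected_vector Cset (xv t, lv t) (- Gp (xv t, lv t) (nu t, eta t, xi t)) u"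
       "((\<lambda>s. (xv s, lv s)) has_vector_derivative u) (at t within {0..})"
       and q: "((\<lambda>t. (nu t, eta t, xi t)) has_vector_derivative Gq (xv t, lv t) (nu t, eta t, xi t)) (at t within {0..})"
      unfolding good_def by blast
    show mem: "(xv t, lv t) \<in> Cset"
      by (rule is_projected_vector_imp_mem[OF closed_Cset ne u(1)])
    show "((\<lambda>t. (nu t, eta t, xi t)) has_vector_derivative Gq (xv t, lv t) (nu t, eta t, xi t)) (at t within {0..})"
      by (rule q)
    show "\<exists>u. ((\<lambda>s. (xv s, lv s)) has_vector_derivative u) (at t within {0..}) \<and>
        (\<forall>r\<in>Cset. (- Gp (xv t, lv t) (nu t, eta t, xi t) - u) \<bullet> (r - (xv t, lv t)) \<le> 0) \<and>
        norm u \<le> norm (Gp (xv t, lv t) (nu t, eta t, xi t))"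
      using u(2) is_projected_vector_normal[OF closed_Cset convex_Cset mem _ u(1)]
        is_projected_vector_norm_le[OF closed_Cset convex_Cset mem u(1)]
      by (intro exI[of _ u]) simp
  qed (rule closed_Cset LPQ_convex LPQ_concave continuous_LPQ continuous_Gp continuous_Gq | assumption)+
  then show thesis by (rule that)
qed

lemma flow_converges_to_saddle:
  assumes flow: "projected_saddle_flow Cset LPQ Gp Gq p q S"
    and sad: "saddle_point LPQ Cset UNIV pS qS" and int: "pS \<in> interior Cset"
  shows "\<exists>pL qL. saddle_point LPQ Cset UNIV pL qL \<and> ((\<lambda>t. (p t, q t)) \<longlongrightarrow> (pL, qL)) at_top"
proof -
  interpret projected_saddle_flow Cset LPQ Gp Gq p q S by (rule flow)
  define x l nu eta xi where "x t = fst (p t)" and "l t = snd (p t)" and "nu t = fst (q t)"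
    and "eta t = fst (snd (q t))" and "xi t = snd (snd (q t))" for t
  note comps = x_def l_def nu_def eta_def xi_def
  obtain xS lS where pS: "pS = (xS, lS)" by (cases pS)
  obtain nS eS kS where qS: "qS = (nS, eS, kS)" by (cases qS) auto
  have GpS: "gradx xS eS kS = 0" "gradl lS nS kS = 0"
    using interior_saddle_imp_Gp_eq_0[OF sad int] by (simp_all add: Gp_def pS qS zero_prod_def)
  have GqS: "Lap *v lS = 0" "LapK *v xS = 0"
    using saddle_imp_Gq_eq_0[OF sad] by (simp_all add: Gq_def pS qS zero_prod_def)
  define mar where "mar k = lS $ v k - a * (norm (last_to_one (block xS (v k))))\<^sup>2" for k
  have mar: "mar k > 0" for k
    using interior_Cset_strict[of xS lS "v k"] int by (simp add: mar_def pS)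
  have mar0: "mar k * (norm y)\<^sup>2 \<ge> 0" for k and y :: "(real, 'm) vec"
    using mar[of k] by simp
  define gap where "gap t = LPQ (p t) qS - LPQ pS (q t)" for t
  have gap0: "(gap \<longlongrightarrow> 0) at_top" unfolding gap_def by (rule gap_tendsto_0[OF sad])
  \<comment> \<open>Both gradients vanish at this saddle point, so the gap is exactly the primal
    remainder minus the dual one, and \<open>remQ_le\<close> bounds the latter.\<close>
  have gap_ge: "gap t \<ge> remP (x t - xS) (l t - lS) kS
      + 1 / real CARD('N) * (\<Sum>k\<in>UNIV. mar k * (norm (xi t $ k - kS $ k))\<^sup>2)" for t
    using LPQ_add_left[of pS "p t - pS" qS] LPQ_add_right[of pS qS "q t - qS"]
      interior_saddle_imp_Gp_eq_0[OF sad int] saddle_imp_Gq_eq_0[OF sad] remQ_le[of xS lS "xi t - kS"]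
    by (simp add: gap_def pS qS comps mar_def)
  have n: "real CARD('N) > 0" by simp
  have sum_nonneg: "1 / real CARD('N) * (\<Sum>k\<in>UNIV. mar k * (norm (xi t $ k - kS $ k))\<^sup>2) \<ge> 0" for t
    by (intro mult_nonneg_nonneg sum_nonneg mar0) simp
  have remP_le: "remP (x t - xS) (l t - lS) kS \<le> gap t" for t
    using gap_ge[of t] sum_nonneg[of t] by linarith
  have xi_lim: "((\<lambda>t. xi t $ k) \<longlongrightarrow> kS $ k) at_top" for k
  proof -
    have "(norm (xi t $ k - kS $ k))\<^sup>2 \<le> real CARD('N) / mar k * gap t" for t
    proof -
      have "mar k * (norm (xi t $ k - kS $ k))\<^sup>2 \<le> (\<Sum>k\<in>UNIV. mar k * (norm (xi t $ k - kS $ k))\<^sup>2)"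
        by (intro member_le_sum mar0) auto
      moreover have "1 / real CARD('N) * (\<Sum>k\<in>UNIV. mar k * (norm (xi t $ k - kS $ k))\<^sup>2) \<le> gap t"
        using gap_ge[of t] remP_nonneg[of "x t - xS" "l t - lS" kS] by linarith
      ultimately have "mar k * (norm (xi t $ k - kS $ k))\<^sup>2 \<le> real CARD('N) * gap t"
        using n by (simp add: field_simps)
      then show ?thesis using mar[of k] by (simp add: field_simps)
    qed
    then have "((\<lambda>t. xi t $ k - kS $ k) \<longlongrightarrow> 0) at_top"
      by (intro tendsto_0_of_square_le[OF always_eventually gap0]) (rule allI)
    then show ?thesis by (rule LIM_zero_cancel)
  qed
  have xi_lim': "(xi \<longlongrightarrow> kS) at_top" by (rule vec_tendstoI) (rule xi_lim)
  have rem_parts: "1 / real CARD('N) * (\<Sum>k\<in>UNIV. a * (last_to_one (kS $ k) \<bullet> block (x t - xS) (v k))\<^sup>2) \<le> gap t"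
    "(x t - xS) \<bullet> (LapK *v (x t - xS)) \<le> 2 * gap t" "(l t - lS) \<bullet> (Lap *v (l t - lS)) \<le> 2 * gap t" for t
  proof -
    have "1 / real CARD('N) * (\<Sum>k\<in>UNIV. a * (last_to_one (kS $ k) \<bullet> block (x t - xS) (v k))\<^sup>2) \<ge> 0"
      using a_pos by (intro mult_nonneg_nonneg Groups_Big.sum_nonneg) auto
    with remP_le[of t] LapK_psd[of "x t - xS"] Lap_psd[of "l t - lS"]
    show "1 / real CARD('N) * (\<Sum>k\<in>UNIV. a * (last_to_one (kS $ k) \<bullet> block (x t - xS) (v k))\<^sup>2) \<le> gap t"
      "(x t - xS) \<bullet> (LapK *v (x t - xS)) \<le> 2 * gap t" "(l t - lS) \<bullet> (Lap *v (l t - lS)) \<le> 2 * gap t"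
      unfolding remP_def by linarith+
  qed
  have gap2: "((\<lambda>t. 2 * gap t) \<longlongrightarrow> 0) at_top" using tendsto_mult_right_zero[OF gap0, of 2] .
  have Lx: "((\<lambda>t. LapK *v x t) \<longlongrightarrow> 0) at_top"
  proof -
    have "((\<lambda>t. LapK *v (x t - xS)) \<longlongrightarrow> 0) at_top"
      by (rule tendsto_psd_matrix_vector[OF transpose_LapK LapK_psd Lim_null_comparison[OF always_eventually gap2]])
         (use rem_parts(2) LapK_psd in auto)
    then show ?thesis by (simp add: matrix_vector_mult_diff_distrib GqS)
  qed
  have Ll: "((\<lambda>t. Lap *v l t) \<longlongrightarrow> 0) at_top"
  proof -
    have "((\<lambda>t. Lap *v (l t - lS)) \<longlongrightarrow> 0) at_top"
      by (rule tendsto_psd_matrix_vector[OF transpose_Lap Lap_psd Lim_null_comparison[OF always_eventually gap2]])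
         (use rem_parts(3) Lap_psd in auto)
    then show ?thesis by (simp add: matrix_vector_mult_diff_distrib GqS)
  qed
  have slope_lim: "((\<lambda>t. last_to_one (kS $ k) \<bullet> block (x t - xS) (v k)) \<longlongrightarrow> 0) at_top" for k
  proof (rule tendsto_0_of_square_le[OF always_eventually gap0], rule allI)
    fix t
    have "a * (last_to_one (kS $ k) \<bullet> block (x t - xS) (v k))\<^sup>2
       \<le> (\<Sum>k\<in>UNIV. a * (last_to_one (kS $ k) \<bullet> block (x t - xS) (v k))\<^sup>2)"
      using a_pos by (intro member_le_sum) auto
    then have "a * (last_to_one (kS $ k) \<bullet> block (x t - xS) (v k))\<^sup>2 \<le> real CARD('N) * gap t"
      using rem_parts(1)[of t] n by (simp add: field_simps)
    then show "(norm (last_to_one (kS $ k) \<bullet> block (x t - xS) (v k)))\<^sup>2 \<le> real CARD('N) / a * gap t"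
      using a_pos by (simp add: field_simps)
  qed
  obtain B where B: "\<And>t. t \<ge> 0 \<Longrightarrow> norm (p t, q t) \<le> B" using bounded_flow[OF sad] by blast
  have Bp: "norm (p t) \<le> B" and Bq: "norm (q t) \<le> B" if "t \<ge> 0" for t
    using B[OF that] norm_fst_le[of "p t" "q t"] norm_snd_le[of "q t" "p t"] by auto
  have Bx: "norm (x t) \<le> B" and Bnu: "norm (nu t) \<le> B" and Beta: "norm (eta t) \<le> B" if "t \<ge> 0" for t
    using Bp[OF that] Bq[OF that] norm_fst_le[of "x t" "l t"]
      norm_fst_le[of "nu t" "snd (q t)"] norm_snd_le[of "snd (q t)" "nu t"] norm_fst_le[of "eta t" "xi t"]
    by (simp_all add: comps)
  have res_lim: "((\<lambda>t. residual (block (x t) (v k)) (xi t $ k)) \<longlongrightarrow> residual (block xS (v k)) (kS $ k)) at_top" for k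
  proof -
    have "((\<lambda>t. last_to_one (xi t $ k) - last_to_one (kS $ k)) \<longlongrightarrow> last_to_one (kS $ k) - last_to_one (kS $ k)) at_top"
      by (intro tendsto_intros xi_lim)
    then have 1: "((\<lambda>t. last_to_one (xi t $ k) - last_to_one (kS $ k)) \<longlongrightarrow> 0) at_top" by simp
    have 2: "\<forall>\<^sub>F t in at_top. norm (block (x t) (v k)) \<le> B"
      using eventually_ge_at_top[of 0] by eventually_elim (use Bx norm_block_le order_trans in blast)
    \<comment> \<open>The residual is its limit plus terms that vanish separately: the merely
      bounded x is paired with the vanishing change of \<open>last_to_one\<close>, and x - xS with
      the fixed limit vector.\<close>
    have "((\<lambda>t. residual (block xS (v k)) (kS $ k) + (xi t $ k $ last_index - kS $ k $ last_index)
       - (last_to_one (xi t $ k) - last_to_one (kS $ k)) \<bullet> block (x t) (v k)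
       - last_to_one (kS $ k) \<bullet> block (x t - xS) (v k)) \<longlongrightarrow>
         residual (block xS (v k)) (kS $ k) + (kS $ k $ last_index - kS $ k $ last_index) - 0 - 0) at_top"
      by (intro tendsto_intros tendsto_vec_nth xi_lim slope_lim tendsto_inner_bounded[OF 1 2])
    moreover have "residual (block xS (v k)) (kS $ k) + (xi t $ k $ last_index - kS $ k $ last_index)
       - (last_to_one (xi t $ k) - last_to_one (kS $ k)) \<bullet> block (x t) (v k)
       - last_to_one (kS $ k) \<bullet> block (x t - xS) (v k) = residual (block (x t) (v k)) (xi t $ k)" for t
      by (simp add: residual_def inner_diff_left inner_diff_right)
    ultimately show ?thesis by simp
  qed
  \<comment> \<open>The multipliers enter \<open>Gp\<close> only through these Laplacian images.
    What remains after subtracting their deviation converges to the gradient at the interior saddle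
    point, which is 0.\<close>
  define E where "E t = Gp (p t) (q t) - (LapK *v (eta t - eS), Lap *v (nu t - nS))" for t
  have E_lim: "(E \<longlongrightarrow> 0) at_top"
  proof -
    have "((\<lambda>t. (1 / real CARD('N)) *\<^sub>R
       (\<Sum>k\<in>UNIV. lift_block (v k) ((- 2 * a * residual (block (x t) (v k)) (xi t $ k)) *\<^sub>R last_to_one (xi t $ k)))
       + LapK *v eS + LapK *v x t) \<longlongrightarrow> (1 / real CARD('N)) *\<^sub>R
       (\<Sum>k\<in>UNIV. lift_block (v k) ((- 2 * a * residual (block xS (v k)) (kS $ k)) *\<^sub>R last_to_one (kS $ k)))
       + LapK *v eS + 0) at_top"
      by (intro tendsto_intros res_lim xi_lim Lx)
    then have Ex: "((\<lambda>t. gradx (x t) (eta t) (xi t) - LapK *v (eta t - eS)) \<longlongrightarrow> 0) at_top"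
      using GpS(1) GqS(2) by (simp add: gradx_def matrix_vector_mult_diff_distrib algebra_simps)
    have "((\<lambda>t. (eps\<^sup>2 / real CARD('n)) *\<^sub>R vec 1
       - (1 / real CARD('N)) *\<^sub>R (\<Sum>k\<in>UNIV. axis (v k) ((norm (xi t $ k - xhat k))\<^sup>2))
       + Lap *v nS + Lap *v l t) \<longlongrightarrow> (eps\<^sup>2 / real CARD('n)) *\<^sub>R vec 1
       - (1 / real CARD('N)) *\<^sub>R (\<Sum>k\<in>UNIV. axis (v k) ((norm (kS $ k - xhat k))\<^sup>2))
       + Lap *v nS + 0) at_top"
      by (intro tendsto_intros xi_lim Ll)
    then have El: "((\<lambda>t. gradl (l t) (nu t) (xi t) - Lap *v (nu t - nS)) \<longlongrightarrow> 0) at_top"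
      using GpS(2) GqS(1) by (simp add: gradl_def matrix_vector_mult_diff_distrib algebra_simps)
    show ?thesis
      using tendsto_Pair[OF Ex El] by (simp add: E_def[abs_def] Gp_def comps zero_prod_def)
  qed
  \<comment> \<open>Along this direction q moves at a rate formed from the vanishing images of
    \<lambda> and x; the zero entry keeps \<xi> out.\<close>
  have slow: "((\<lambda>t. Gq (p t) (q t) \<bullet> (Lap *v snd r, LapK *v fst r, 0)) \<longlongrightarrow> 0) at_top" for r
  proof -
    have "((\<lambda>t. (Lap *v l t) \<bullet> (Lap *v snd r) + (LapK *v x t) \<bullet> (LapK *v fst r)) \<longlongrightarrow> 0 \<bullet> (Lap *v snd r) + 0 \<bullet> (LapK *v fst r)) at_top"
      by (intro tendsto_intros Lx Ll)
    then show ?thesis by (simp add: Gq_def inner_prod_def comps)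
  qed
  have var_gap: "((\<lambda>t. Gp (p t) (q t) \<bullet> (p t - r) + (q t - qS) \<bullet> (Lap *v snd r, LapK *v fst r, 0)) \<longlongrightarrow> 0) at_top" for r
  proof -
    have 1: "\<forall>\<^sub>F t in at_top. norm (p t - r) \<le> B + norm r"
      using eventually_ge_at_top[of 0]
      by eventually_elim (use Bp norm_triangle_ineq4 add_right_mono order_trans in blast)
    have 2: "\<forall>\<^sub>F t in at_top. norm (eta t - eS) \<le> B + norm eS"
      using eventually_ge_at_top[of 0]
      by eventually_elim (use Beta norm_triangle_ineq4 add_right_mono order_trans in blast)
    have 3: "\<forall>\<^sub>F t in at_top. norm (nu t - nS) \<le> B + norm nS"
      using eventually_ge_at_top[of 0]
      by eventually_elim (use Bnu norm_triangle_ineq4 add_right_mono order_trans in blast)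
    have "((\<lambda>t. E t \<bullet> (p t - r) + (LapK *v x t) \<bullet> (eta t - eS) + (Lap *v l t) \<bullet> (nu t - nS)) \<longlongrightarrow> 0 + 0 + 0) at_top"
      by (intro tendsto_add tendsto_inner_bounded[OF E_lim 1] tendsto_inner_bounded[OF Lx 2] tendsto_inner_bounded[OF Ll 3])
    \<comment> \<open>Symmetry moves the Laplacians from the multipliers onto p - r: the part on p
      vanishes in the limit, and the part on r is the constant direction.\<close>
    moreover have "E t \<bullet> (p t - r) + (LapK *v x t) \<bullet> (eta t - eS) + (Lap *v l t) \<bullet> (nu t - nS)
       = Gp (p t) (q t) \<bullet> (p t - r) + (q t - qS) \<bullet> (Lap *v snd r, LapK *v fst r, 0)" for t
    proof -
      have "E t \<bullet> (p t - r) = Gp (p t) (q t) \<bullet> (p t - r) - (LapK *v (eta t - eS)) \<bullet> (x t - fst r) - (Lap *v (nu t - nS)) \<bullet> (l t - snd r)"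
        by (simp add: E_def inner_diff_left comps inner_prod_def[of "(_, _)" "p t - r"])
      moreover have "(q t - qS) \<bullet> (Lap *v snd r, LapK *v fst r, 0) = (nu t - nS) \<bullet> (Lap *v snd r) + (eta t - eS) \<bullet> (LapK *v fst r)"
        by (simp add: inner_prod_def qS comps)
      moreover have "(LapK *v (eta t - eS)) \<bullet> (x t - fst r) = (LapK *v x t) \<bullet> (eta t - eS) - (eta t - eS) \<bullet> (LapK *v fst r)"
        by (subst inner_LapK) (simp only: matrix_vector_mult_diff_distrib[of LapK "x t"] inner_diff_right[of "eta t - eS"]
            inner_commute[of "LapK *v x t"])
      moreover have "(Lap *v (nu t - nS)) \<bullet> (l t - snd r) = (Lap *v l t) \<bullet> (nu t - nS) - (nu t - nS) \<bullet> (Lap *v snd r)"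
        by (subst inner_Lap) (simp only: matrix_vector_mult_diff_distrib[of Lap "l t"] inner_diff_right[of "nu t - nS"]
            inner_commute[of "Lap *v l t"])
      ultimately show ?thesis by linarith
    qed
    ultimately show ?thesis by simp
  qed
  have "bounded (range (\<lambda>n. (p (real n), q (real n))))"
    unfolding bounded_iff by (intro exI[of _ B] ballI, elim rangeE) (simp add: B)
  from bounded_imp_convergent_subsequence[OF this] obtain zL \<sigma> where
    \<sigma>: "strict_mono \<sigma>" "((\<lambda>n. (p (real n), q (real n))) \<circ> \<sigma>) \<longlonglongrightarrow> zL" by blast
  define \<tau> where "\<tau> n = real (\<sigma> n)" for n :: nat
  have \<tau>: "filterlim \<tau> at_top sequentially"
    unfolding \<tau>_def by (rule filterlim_compose[OF filterlim_real_sequentially filterlim_subseq[OF \<sigma>(1)]])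
  obtain pL qL where zL: "zL = (pL, qL)" by (cases zL)
  have lim: "(\<lambda>n. (p (\<tau> n), q (\<tau> n))) \<longlonglongrightarrow> (pL, qL)"
    using \<sigma>(2) by (simp add: \<tau>_def comp_def zL)
  have limp: "(\<lambda>n. p (\<tau> n)) \<longlonglongrightarrow> pL" and limq: "(\<lambda>n. q (\<tau> n)) \<longlonglongrightarrow> qL"
    using tendsto_fst[OF lim] tendsto_snd[OF lim] by simp_all
  have pL: "pL \<in> Cset"
    by (rule Lim_in_closed_set[OF closed_Cset always_eventually[OF allI] sequentially_bot limp])
       (auto simp: \<tau>_def intro: mem)
  have along: "(\<lambda>n. F (p (\<tau> n)) (q (\<tau> n))) \<longlonglongrightarrow> F pL qL"
    if "continuous_on UNIV (\<lambda>z. F (fst z) (snd z))" for F :: "_ \<Rightarrow> _ \<Rightarrow> 'c::topological_space"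
    using continuous_on_tendsto_compose[OF that lim] by simp
  \<comment> \<open>A continuous function of the state that converges along the whole flow must take
    its limit as value at the limit point.\<close>
  have lim_eq: "F pL qL = y"
    if "continuous_on UNIV (\<lambda>z. F (fst z) (snd z))" "((\<lambda>t. F (p t) (q t)) \<longlongrightarrow> y) at_top"
    for F :: "_ \<Rightarrow> _ \<Rightarrow> 'c::t2_space" and y
    by (rule LIMSEQ_unique[OF along[OF that(1)] filterlim_compose[OF that(2) \<tau>]])
  have LL: "LapK *v fst pL = 0" "Lap *v snd pL = 0"
    using Lx Ll by (auto simp: comps intro!: lim_eq[of "\<lambda>p q. LapK *v fst p"] lim_eq[of "\<lambda>p q. Lap *v snd p"] continuous_intros)
  \<comment> \<open>Because \<xi> converges, its rate tends to 0 in every direction, which makes the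
    limit point stationary in \<xi>.\<close>
  have "Gq pL qL \<bullet> (0, 0, h) = 0" for h
  proof (rule lim_eq[of "\<lambda>p q. Gq p q \<bullet> (0, 0, h)"])
    show "continuous_on UNIV (\<lambda>z. Gq (fst z) (snd z) \<bullet> (0, 0, h))"
      by (intro continuous_intros continuous_Gq)
    have "((\<lambda>t. xi t \<bullet> h) \<longlongrightarrow> kS \<bullet> h) at_top" by (intro tendsto_intros xi_lim')
    then have "((\<lambda>t. q t \<bullet> (0, 0, h)) \<longlongrightarrow> kS \<bullet> h) at_top" by (simp add: comps inner_prod_def)
    then show "((\<lambda>t. Gq (p t) (q t) \<bullet> (0, 0, h)) \<longlongrightarrow> 0) at_top"
      by (rule Gq_inner_tendsto_0[OF sad])
  qed
  then have "gradxi (fst pL) (snd pL) (snd (snd qL)) \<bullet> h = 0" for h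
    by (simp add: Gq_def inner_prod_def)
  then have "gradxi (fst pL) (snd pL) (snd (snd qL)) = 0"
    using inner_eq_zero_iff by blast
  with LL have GqL: "Gq pL qL = 0" by (simp add: Gq_def zero_prod_def)
  have "Gp pL qL - (LapK *v (fst (snd qL) - eS), Lap *v (fst qL - nS)) = 0"
  proof (rule lim_eq[of "\<lambda>p q. Gp p q - (LapK *v (fst (snd q) - eS), Lap *v (fst q - nS))"])
    show "continuous_on UNIV (\<lambda>z. Gp (fst z) (snd z) - (LapK *v (fst (snd (snd z)) - eS), Lap *v (fst (snd z) - nS)))"
      by (intro continuous_intros continuous_Gp)
    show "((\<lambda>t. Gp (p t) (q t) - (LapK *v (fst (snd (q t)) - eS), Lap *v (fst (q t) - nS))) \<longlongrightarrow> 0) at_top"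
      using E_lim by (simp add: E_def[abs_def] comps)
  qed
  then have GpL: "Gp pL qL = (LapK *v (fst (snd qL) - eS), Lap *v (fst qL - nS))" by simp
  have "saddle_point LPQ Cset UNIV pL qL"
    unfolding saddle_point_def
  proof (intro conjI ballI pL UNIV_I)
    fix r
    show "LPQ pL r \<le> LPQ pL qL"
      using LPQ_concave[OF pL, of r qL] by (simp add: GqL)
  next
    fix r assume r: "r \<in> Cset"
    have "0 \<le> (qL - qS) \<bullet> (Lap *v snd r, LapK *v fst r, 0)"
      by (rule limit_point_variational[OF sad r var_gap slow \<tau> limq])
    \<comment> \<open>The Laplacian images of pL vanish, so r may be replaced by r - pL and the
      inequality becomes the first-order condition; convexity then gives global minimality over
      \<open>Cset\<close>.\<close>
    also have "\<dots> = Gp pL qL \<bullet> (r - pL)"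
    proof -
      have "LapK *v (fst r - fst pL) = LapK *v fst r" "Lap *v (snd r - snd pL) = Lap *v snd r"
        by (simp_all add: matrix_vector_mult_diff_distrib LL)
      then show ?thesis by (simp add: GpL inner_prod_def qS inner_LapK inner_Lap)
    qed
    also have "\<dots> \<le> LPQ r qL - LPQ pL qL" by (rule LPQ_convex)
    finally show "LPQ pL qL \<le> LPQ r qL" by simp
  qed
  with converges_to_saddle_limit_point[OF this \<tau> lim] show ?thesis by blast
qed

end

theorem mainTheorem11:
  fixes E :: "('n::finite \<times> 'n) set" and A :: "real^'n^'n"
    and xhat :: "'N::finite \<Rightarrow> real^('m::{finite,linorder})" and v :: "'N \<Rightarrow> 'n"
    and eps a :: real
    and f :: "real^('m::{finite,linorder}) \<Rightarrow> real^('m::{finite,linorder}) \<Rightarrow> real"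
    and C :: "((real^('n \<times> 'm::{finite,linorder})) \<times> (real^'n)) set"
  assumes graph: "connected_weighted_graph E A"
    and holders: "surj v"
    and eps: "eps \<ge> 0"
    and a: "a > 0"
    and f: "\<And>x \<xi>. f x \<xi> = a * (\<xi> $ last_index - last_to_one \<xi> \<bullet> x)\<^sup>2"
    and C: "C = {(xv, lv). (\<forall>i. lv $ i \<ge> 0) \<and>
                            (\<forall>i. lv $ i \<ge> a * (norm (last_to_one (block xv i)))\<^sup>2)}"
    and standing: "standing_assumption f xhat eps"
    and saddle: "\<exists>p q. saddle_L_aug A f xhat v eps C p q \<and> p \<in> interior C"
  shows "\<forall>xv lv nu eta xi.
           SP_trajectory A f xhat v eps C xv lv nu eta xi \<and> (xv 0, lv 0) \<in> C \<longrightarrow>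
             (\<forall>t\<ge>0. (xv t, lv t) \<in> C) \<and>
             (\<exists>p q. saddle_L_aug A f xhat v eps C p q \<and>
                    ((\<lambda>t. ((xv t, lv t), (nu t, eta t, xi t))) \<longlongrightarrow> (p, q)) at_top) \<and>
             (\<exists>p. optimizer_D A f xhat v eps p \<and> ((\<lambda>t. (xv t, lv t)) \<longlongrightarrow> p) at_top)"
proof -
  have A: "A $ i $ j \<ge> 0" for i j
    using graph unfolding connected_weighted_graph_def by (metis less_imp_le order_refl)
  interpret regression A xhat v eps a
    by unfold_locales (use graph holders a A in \<open>auto simp: connected_weighted_graph_def\<close>)
  have f_eq: "f = loss" by (intro ext) (simp add: f loss_def)
  have C_eq: "C = Cset" by (simp add: C Cset_def)
  obtain pS qS where sad: "saddle_point LPQ Cset UNIV pS qS" and int: "pS \<in> interior Cset"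
    using saddle unfolding f_eq C_eq saddle_L_aug_iff by blast
  show ?thesis
    unfolding f_eq C_eq saddle_L_aug_iff
  proof (intro allI impI, elim conjE)
    fix xv lv nu eta xi
    assume traj: "SP_trajectory A loss xhat v eps Cset xv lv nu eta xi" and init: "(xv 0, lv 0) \<in> Cset"
    obtain S where flow: "projected_saddle_flow Cset LPQ Gp Gq (\<lambda>t. (xv t, lv t)) (\<lambda>t. (nu t, eta t, xi t)) S"
      using SP_trajectory_imp_flow[OF traj init] by blast
    obtain p q where sad': "saddle_point LPQ Cset UNIV p q"
      and lim: "((\<lambda>t. ((xv t, lv t), (nu t, eta t, xi t))) \<longlongrightarrow> (p, q)) at_top"
      using flow_converges_to_saddle[OF flow sad int] by blast
    have "((\<lambda>t. (xv t, lv t)) \<longlongrightarrow> p) at_top" using tendsto_fst[OF lim] by simp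
    then show "(\<forall>t\<ge>0. (xv t, lv t) \<in> Cset) \<and>
             (\<exists>p q. saddle_point LPQ Cset UNIV p q \<and>
                    ((\<lambda>t. ((xv t, lv t), (nu t, eta t, xi t))) \<longlongrightarrow> (p, q)) at_top) \<and>
             (\<exists>p. optimizer_D A loss xhat v eps p \<and> ((\<lambda>t. (xv t, lv t)) \<longlongrightarrow> p) at_top)"
      using projected_saddle_flow.mem[OF flow] sad' lim saddle_imp_optimizer_D[OF sad'] by blast
  qed
qed

end
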